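(* Let $1<p<\infty$, $\alpha>-1$ and $p>1+\alpha$, and let $\Theta$ be an inner function. Then $$\|\Theta'\|_{A_p(\alpha)}^p\le I_{p,\alpha}(\Theta)\le K_{p,\alpha}^p\,\|\Theta'\|_{A_p(\alpha)}^p,$$ where $$K_{p,\alpha}^p=\frac{2^{\frac1{\alpha+1}}}{2^{\frac1{\alpha+1}}-1}\left(\frac{p}{p-1-\alpha}\right)^p2^{p+1}.$$
   Context: $\mathbb{D}$ is the open unit disc and $A$ the normalized area measure on $\mathbb{D}$. An inner function is $\Theta\in H^\infty$ with $|\Theta|=1$ a.e. on the unit circle. For holomorphic $h$ in $\mathbb{D}$, $\|h\|_{A_p(\alpha)}^p=\int_{\mathbb{D}}(1-|u|^2)^\alpha|h(u)|^p\,dA(u)\in[0,\infty]$. For $p>1$, $\alpha>-1$, $$I_{p,\alpha}(\Theta)=\int_{\mathbb{D}}(1-|u|^2)^\alpha\left(\frac{1-|\Theta(u)|^2}{1-|u|^2}\right)^p dA(u)\in[0,\infty].$$ *)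

theory Defs
  imports "HOL-Complex_Analysis.Complex_Analysis"
begin

abbreviation unit_disc :: "complex set"
  where "unit_disc \<equiv> ball 0 1"

definition area_measure :: "complex measure"
  where "area_measure = uniform_measure lborel unit_disc"

definition H_infinity :: "(complex \<Rightarrow> complex) set"
  where "H_infinity = {f. f holomorphic_on unit_disc \<and> bounded (f ` unit_disc)}"

text \<open>
  The boundary value of a function in \<open>H\<^sup>\<infinity>\<close> at \<open>cis t\<close> is its radial limit, which exists for
  almost every \<open>t\<close> by Fatou's theorem.
\<close>

definition has_radial_limit :: "(complex \<Rightarrow> complex) \<Rightarrow> complex \<Rightarrow> complex \<Rightarrow> bool"
  where "has_radial_limit f \<zeta> w \<longleftrightarrow> ((\<lambda>r. f (complex_of_real r * \<zeta>)) \<longlongrightarrow> w) (at_left (1::real))"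

definition inner_function :: "(complex \<Rightarrow> complex) \<Rightarrow> bool"
  where "inner_function \<Theta> \<longleftrightarrow> \<Theta> \<in> H_infinity \<and>
    (AE t in lborel. t \<in> {0..2 * pi} \<longrightarrow> (\<exists>w. has_radial_limit \<Theta> (cis t) w \<and> cmod w = 1))"

text \<open>
  The \<open>p\<close>-th power of the weighted Bergman norm. The restriction to the disc is kept in the
  integrand because functions are arbitrary, possibly nonmeasurable, outside the disc.
\<close>

definition bergman_norm_pow :: "real \<Rightarrow> real \<Rightarrow> (complex \<Rightarrow> complex) \<Rightarrow> ennreal"
  where "bergman_norm_pow p \<alpha> h =
    (\<integral>\<^sup>+u\<in>unit_disc. ennreal ((1 - (cmod u)\<^sup>2) powr \<alpha> * cmod (h u) powr p) \<partial>area_measure)"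

definition I_integral :: "real \<Rightarrow> real \<Rightarrow> (complex \<Rightarrow> complex) \<Rightarrow> ennreal"
  where "I_integral p \<alpha> \<Theta> =
    (\<integral>\<^sup>+u\<in>unit_disc. ennreal ((1 - (cmod u)\<^sup>2) powr \<alpha> *
        ((1 - (cmod (\<Theta> u))\<^sup>2) / (1 - (cmod u)\<^sup>2)) powr p) \<partial>area_measure)"

text \<open>The \<open>p\<close>-th power of the constant \<open>K\<close>.\<close>

definition K_pow :: "real \<Rightarrow> real \<Rightarrow> real"
  where "K_pow p \<alpha> =
    2 powr (1 / (\<alpha> + 1)) / (2 powr (1 / (\<alpha> + 1)) - 1) * (p / (p - 1 - \<alpha>)) powr p * 2 powr (p + 1)"

end

theory Submission
  imports Defs
begin

text \<open>
  The lower estimate is the Schwarz--Pick lemma, integrated. For the upper estimate, almost every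
  radius ends at a boundary value of modulus one, so that \<open>1 - \<bar>\<Theta>(r\<zeta>)\<bar>\<^sup>2\<close> is at most
  \<open>2 \<integral>\<^sub>r\<^sup>1 \<bar>\<Theta>'(s\<zeta>)\<bar> ds\<close>, and Hardy's inequality along the radius, with the
  sharp constant \<open>(p / (p - 1 - \<alpha>))\<^sup>p\<close>, bounds \<open>I\<close> by the integral of
  \<open>(1 - r) powr \<alpha>\<close> against the integral means of \<open>\<bar>\<Theta>'\<bar>\<^sup>p\<close> on circles. The Jacobian factor
  \<open>2 r\<close> missing in that bound is restored because these means increase with the radius: the part of
  \<open>(0, 1)\<close> beyond \<open>1 - 2 powr (- 1 / (\<alpha> + 1))\<close> carries half of the weight, and there \<open>r\<close> is
  bounded below. This produces the remaining factor of the constant.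
\<close>

section \<open>Polar coordinates on the unit disc\<close>

text \<open>Membership in \<open>inner_function\<close> bounds \<open>\<Theta>\<close> inside the
  disc by some constant, not by 1. The bound 1 has to be recovered from the boundary values before
  anything else, because both the Schwarz--Pick lemma and the nonnegativity of
  \<open>1 - cmod (\<Theta> u)\<close> in Hardy's inequality rest on it. In the upper estimate
  Hardy's inequality works at a fixed angle, whereas the comparison of integral means needs the
  angle integrated out at each radius; hence the order of integration is exchanged twice. The factor
  \<open>2 powr (p + 1)\<close> of the constant has two sources: \<open>2 powr p\<close> comes from
  \<open>1 - \<tau>^2 \<le> 2 * (1 - \<tau>)\<close>, and one further 2 from returning from the
  weight in \<open>1 - r\<close> to the weight in \<open>1 - r^2\<close>.\<close>

lemma nn_integral_complex:
  assumes [measurable]: "f \<in> borel_measurable (borel :: complex measure)"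
  shows "(\<integral>\<^sup>+u. f u \<partial>lborel) = (\<integral>\<^sup>+x. \<integral>\<^sup>+y. f (Complex x y) \<partial>lborel \<partial>lborel)"
    and "(\<integral>\<^sup>+u. f u \<partial>lborel) = (\<integral>\<^sup>+y. \<integral>\<^sup>+x. f (Complex x y) \<partial>lborel \<partial>lborel)"
proof -
  have [measurable]: "case_prod Complex \<in> borel_measurable (borel :: (real \<times> real) measure)"
    by (intro borel_measurable_continuous_onI) (auto simp: Complex_eq split_beta intro!: continuous_intros)
  have eq: "(lborel :: complex measure) = distr lborel borel (case_prod Complex)"
  proof (rule lborel_eqI)
    fix l u :: complex
    assume le: "\<And>b. b \<in> Basis \<Longrightarrow> l \<bullet> b \<le> u \<bullet> b"
    have "case_prod Complex -` box l u = box (Re l, Im l) (Re u, Im u)"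
      by (auto simp: box_def Basis_complex_def Basis_prod_def inner_complex_def)
    then show "emeasure (distr lborel borel (case_prod Complex)) (box l u) = (\<Prod>b\<in>Basis. (u - l) \<bullet> b)"
      using le[of 1] le[of \<i>]
      by (simp add: emeasure_distr emeasure_lborel_box_eq Basis_prod_def Basis_complex_def inner_complex_def ball_Un
          prod.union_disjoint)
  qed simp
  have m[measurable]: "(\<lambda>z. f (case_prod Complex z)) \<in> borel_measurable (lborel \<Otimes>\<^sub>M lborel)"
    unfolding lborel_prod by measurable
  have *: "(\<integral>\<^sup>+u. f u \<partial>lborel) = (\<integral>\<^sup>+z. f (case_prod Complex z) \<partial>(lborel \<Otimes>\<^sub>M lborel))"
    by (subst eq, subst nn_integral_distr) (simp_all add: lborel_prod)
  then show "(\<integral>\<^sup>+u. f u \<partial>lborel) = (\<integral>\<^sup>+x. \<integral>\<^sup>+y. f (Complex x y) \<partial>lborel \<partial>lborel)"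
    using lborel.nn_integral_fst[OF m] by simp
  show "(\<integral>\<^sup>+u. f u \<partial>lborel) = (\<integral>\<^sup>+y. \<integral>\<^sup>+x. f (Complex x y) \<partial>lborel \<partial>lborel)"
    using lborel_pair.nn_integral_snd[OF m] * by simp
qed

text \<open>A shear translates every line parallel to one of the axes, so one-dimensional
  translation invariance suffices once the moved coordinate is the inner variable of integration.
  This is why both orders of integration were recorded.\<close>

lemma nn_integral_shear:
  assumes [measurable]: "f \<in> borel_measurable (borel :: complex measure)"
  shows "(\<integral>\<^sup>+u. f (Complex (Re u + a * Im u) (Im u)) \<partial>lborel) = (\<integral>\<^sup>+u. f u \<partial>lborel)"
    and "(\<integral>\<^sup>+u. f (Complex (Re u) (Im u + a * Re u)) \<partial>lborel) = (\<integral>\<^sup>+u. f u \<partial>lborel)"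
proof -
  have C: "(\<lambda>x. Complex x y) \<in> borel_measurable borel" "(\<lambda>x. Complex y x) \<in> borel_measurable borel" for y
    by (auto intro!: borel_measurable_continuous_onI continuous_intros simp: Complex_eq)
  have [measurable]: "(\<lambda>x. f (Complex x y)) \<in> borel_measurable borel" 
     "(\<lambda>x. f (Complex y x)) \<in> borel_measurable borel" for y
    using C by (auto intro!: measurable_compose[OF _ assms])
  have [measurable]: "(\<lambda>u. Complex (Re u + a * Im u) (Im u)) \<in> borel_measurable borel" 
     "(\<lambda>u. Complex (Re u) (Im u + a * Re u)) \<in> borel_measurable borel"
    by (auto intro!: borel_measurable_continuous_onI continuous_intros simp: Complex_eq)
  show "(\<integral>\<^sup>+u. f (Complex (Re u + a * Im u) (Im u)) \<partial>lborel) = (\<integral>\<^sup>+u. f u \<partial>lborel)"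
    using nn_integral_real_affine[of "\<lambda>x. f (Complex x y)" 1 "a * y" for y]
    by (simp add: nn_integral_complex(2) add.commute)
  show "(\<integral>\<^sup>+u. f (Complex (Re u) (Im u + a * Re u)) \<partial>lborel) = (\<integral>\<^sup>+u. f u \<partial>lborel)"
    using nn_integral_real_affine[of "\<lambda>y. f (Complex x y)" 1 "a * x" for x]
    by (simp add: nn_integral_complex(1) add.commute)
qed

text \<open>A rotation other than \<open>u \<mapsto> - u\<close> is a composition of three shears.\<close>
lemma nn_integral_rotate:
  assumes f[measurable]: "f \<in> borel_measurable (borel :: complex measure)" and "cmod c = 1"
  shows "(\<integral>\<^sup>+u. f (c * u) \<partial>lborel) = (\<integral>\<^sup>+u. f u \<partial>lborel)"
proof -
  have main: "(\<integral>\<^sup>+u. g (c * u) \<partial>lborel) = (\<integral>\<^sup>+u. g u \<partial>lborel)"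
    if [measurable]: "g \<in> borel_measurable borel" and c: "cmod c = 1" "c \<noteq> - 1" for c and g :: "complex \<Rightarrow> ennreal"
  proof -
    have sq: "(Re c)\<^sup>2 + (Im c)\<^sup>2 = 1"
      using c(1) by (metis cmod_power2 power_one)
    \<comment> \<open>On the unit circle only \<open>- 1\<close> has real part \<open>- 1\<close>;
      this is the rotation excluded from the shear factorization.\<close>
    have ne: "1 + Re c \<noteq> 0"
    proof
      assume "1 + Re c = 0"
      then have "Re c = - 1" by simp
      with sq have "c = - 1" by (simp add: complex_eq_iff)
      with c(2) show False by simp
    qed
    \<comment> \<open>For \<open>c = cis \<theta>\<close> this is
      \<open>- tan (\<theta> / 2)\<close>: the rotation factors as a horizontal shear by it, a
      vertical shear by \<open>sin \<theta>\<close>, and the same horizontal shear again.\<close>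
    define a where "a = - Im c / (1 + Re c)"
    define S where "S u = Complex (Re u + a * Im u) (Im u)" for u
    define V where "V u = Complex (Re u) (Im u + Im c * Re u)" for u
    have [measurable]: "S \<in> borel_measurable borel" "V \<in> borel_measurable borel"
      unfolding S_def V_def
      by (auto intro!: borel_measurable_continuous_onI continuous_intros simp: Complex_eq)
    have "1 + a * Im c = Re c" 
      using ne sq by (simp add: a_def field_simps power2_eq_square)
    moreover have "a * (1 + Re c) = - Im c"
      using ne by (simp add: a_def)
    ultimately have k: "Re c = 1 + a * Im c" "Im c = - (a * (1 + Re c))" by auto
    have SVS: "c * u = S (V (S u))" for u
    proof (rule complex_eqI)
      have "Re (S (V (S u))) = (1 + a * Im c) * Re u + (a * (1 + (1 + a * Im c))) * Im u"
        by (simp add: S_def V_def algebra_simps)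
      also have "\<dots> = Re c * Re u - Im c * Im u"
        using k by (smt (verit) mult_minus_left)
      finally show "Re (c * u) = Re (S (V (S u)))" by simp
      have "Im (S (V (S u))) = (1 + a * Im c) * Im u + Im c * Re u"
        by (simp add: S_def V_def algebra_simps)
      then show "Im (c * u) = Im (S (V (S u)))" using k(1) by simp
    qed
    have nn_S: "(\<integral>\<^sup>+u. h (S u) \<partial>lborel) = (\<integral>\<^sup>+u. h u \<partial>lborel)"
      if "h \<in> borel_measurable borel" for h :: "complex \<Rightarrow> ennreal"
      using nn_integral_shear(1)[OF that, of a] by (simp add: S_def)
    have nn_V: "(\<integral>\<^sup>+u. h (V u) \<partial>lborel) = (\<integral>\<^sup>+u. h u \<partial>lborel)"
      if "h \<in> borel_measurable borel" for h :: "complex \<Rightarrow> ennreal"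
      using nn_integral_shear(2)[OF that, of "Im c"] by (simp add: V_def)
    have "(\<integral>\<^sup>+u. g (c * u) \<partial>lborel) = (\<integral>\<^sup>+u. g (S (V (S u))) \<partial>lborel)"
      by (simp add: SVS)
    also have "\<dots> = (\<integral>\<^sup>+u. g (S (V u)) \<partial>lborel)"
      by (rule nn_S) measurable
    also have "\<dots> = (\<integral>\<^sup>+u. g (S u) \<partial>lborel)"
      by (rule nn_V) measurable
    also have "\<dots> = (\<integral>\<^sup>+u. g u \<partial>lborel)"
      by (rule nn_S) measurable
    finally show ?thesis .
  qed
  show ?thesis
  proof (cases "c = - 1")
    case True
    \<comment> \<open>The excluded half turn is the quarter turn applied twice.\<close>
    have i: "cmod \<i> = 1" "\<i> \<noteq> - 1" by (auto simp: complex_eq_iff)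
    have "(\<integral>\<^sup>+u. f (\<i> * (\<i> * u)) \<partial>lborel) = (\<integral>\<^sup>+u. f (\<i> * u) \<partial>lborel)"
      using i by (intro main[of "\<lambda>u. f (\<i> * u)"]) measurable
    also have "\<dots> = (\<integral>\<^sup>+u. f u \<partial>lborel)"
      using i by (intro main) measurable
    finally show ?thesis
      by (simp add: True flip: mult.assoc)
  next
    case False
    then show ?thesis using assms by (intro main)
  qed
qed

section \<open>Circle means and integration in polar coordinates\<close>

text \<open>The variable is the angle rather than the point of the circle, which matches the null
  sets of angles in \<open>inner_function\<close>. The total mass is 1, like that of
  \<open>area_measure\<close>.\<close>

definition circle_mean :: "real measure"
  where "circle_mean = uniform_measure lborel {0..2 * pi}"

lemma sets_circle_mean [measurable_cong, simp]: "sets circle_mean = sets borel"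
  and space_circle_mean [simp]: "space circle_mean = UNIV"
  by (simp_all add: circle_mean_def)

lemma sets_area_measure [measurable_cong, simp]: "sets area_measure = sets borel"
  and space_area_measure [simp]: "space area_measure = UNIV"
  by (simp_all add: area_measure_def)

lemma emeasure_circle_mean_UNIV: "emeasure circle_mean UNIV = 1"
  by (simp add: circle_mean_def ennreal_divide_self)

lemma emeasure_unit_disc: "emeasure lborel unit_disc = ennreal pi"
  by (simp add: emeasure_ball eval_unit_ball_vol)

lemma emeasure_area_measure_UNIV: "emeasure area_measure UNIV = 1"
  by (simp add: area_measure_def emeasure_unit_disc ennreal_divide_self)

interpretation circle_mean: finite_measure circle_mean
  by (rule finite_measureI) (simp add: emeasure_circle_mean_UNIV)

interpretation area_measure: finite_measure area_measure
  by (rule finite_measureI) (simp add: emeasure_area_measure_UNIV)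

interpretation circle_area: pair_sigma_finite circle_mean area_measure ..
interpretation circle_line: pair_sigma_finite circle_mean "lborel :: real measure" ..

lemma nn_integral_circle_mean:
  assumes [measurable]: "f \<in> borel_measurable borel"
  shows "(\<integral>\<^sup>+t. f t \<partial>circle_mean) = (\<integral>\<^sup>+t\<in>{0..2*pi}. f t \<partial>lborel) / ennreal (2 * pi)"
  unfolding circle_mean_def by (subst nn_integral_uniform_measure) simp_all

text \<open>The window \<open>{a..2*pi+a}\<close> is cut at \<open>2*pi\<close> and the piece beyond
  it is moved back by one period; the two pieces then tile \<open>{0..2*pi}\<close>.\<close>

lemma nn_integral_circle_mean_shift:
  assumes f[measurable]: "f \<in> borel_measurable borel" and per: "\<And>t. f (t + 2 * pi) = f t" and a: "0 \<le> a" "a \<le> 2 * pi"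
  shows "(\<integral>\<^sup>+t. f (t + a) \<partial>circle_mean) = (\<integral>\<^sup>+t. f t \<partial>circle_mean)"
proof -
  have sh: "(\<integral>\<^sup>+t. g (t + c) \<partial>lborel) = (\<integral>\<^sup>+t. g t \<partial>lborel)" 
    if "g \<in> borel_measurable borel" for c and g :: "real \<Rightarrow> ennreal"
    using nn_integral_real_affine[OF that, of 1 c] by (simp add: add.commute)
  have split: "(\<integral>\<^sup>+t\<in>{x..z}. f t \<partial>lborel) = (\<integral>\<^sup>+t\<in>{x..y}. f t \<partial>lborel) + (\<integral>\<^sup>+t\<in>{y..z}. f t \<partial>lborel)"
    if "x \<le> y" "y \<le> z" for x y z
  proof -
    have "(\<integral>\<^sup>+t\<in>{x..z}. f t \<partial>lborel) = (\<integral>\<^sup>+t. f t * indicator {x..y} t + f t * indicator {y..z} t \<partial>lborel)"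
      using that
      by (intro nn_integral_cong_AE eventually_mono[OF AE_lborel_singleton[of y]]) (auto split: split_indicator)
    then show ?thesis by (simp add: nn_integral_add)
  qed
  have "(\<integral>\<^sup>+t\<in>{0..2*pi}. f (t + a) \<partial>lborel) = (\<integral>\<^sup>+t. f (t + a) * indicator {a..2*pi+a} (t + a) \<partial>lborel)"
    by (intro nn_integral_cong) (auto split: split_indicator)
  also have "\<dots> = (\<integral>\<^sup>+t\<in>{a..2*pi+a}. f t \<partial>lborel)"
    by (rule sh) simp
  also have "\<dots> = (\<integral>\<^sup>+t\<in>{a..2*pi}. f t \<partial>lborel) + (\<integral>\<^sup>+t\<in>{2*pi..2*pi+a}. f t \<partial>lborel)"
    using a by (intro split) auto
  also have "(\<integral>\<^sup>+t\<in>{2*pi..2*pi+a}. f t \<partial>lborel) = (\<integral>\<^sup>+t. f (t + 2*pi) * indicator {2*pi..2*pi+a} (t + 2*pi) \<partial>lborel)"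
    by (rule sh[symmetric]) simp
  also have "\<dots> = (\<integral>\<^sup>+t\<in>{0..a}. f t \<partial>lborel)"
    by (intro nn_integral_cong) (auto split: split_indicator simp: per)
  also have "(\<integral>\<^sup>+t\<in>{a..2*pi}. f t \<partial>lborel) + (\<integral>\<^sup>+t\<in>{0..a}. f t \<partial>lborel) = (\<integral>\<^sup>+t\<in>{0..2*pi}. f t \<partial>lborel)"
    using split[of 0 a "2*pi"] a by (simp add: add.commute)
  finally show ?thesis
    by (simp add: nn_integral_circle_mean)
qed

lemma nn_integral_area_measure:
  assumes [measurable]: "f \<in> borel_measurable borel"
  shows "(\<integral>\<^sup>+u. f u \<partial>area_measure) = (\<integral>\<^sup>+u\<in>unit_disc. f u \<partial>lborel) / ennreal pi"
  unfolding area_measure_def by (subst nn_integral_uniform_measure) (simp_all add: emeasure_unit_disc)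

text \<open>Only areas of discs are needed: outside the closed disc of radius \<open>x\<close> in
  [0, 1) the normalized area is \<open>1 - x^2\<close>, and half-lines determine a finite measure on
  the reals.\<close>

lemma distr_area_measure_cmod:
  "distr area_measure borel cmod = density lborel (\<lambda>r. ennreal (2 * r) * indicator {0<..<1} r)"
proof (rule measure_eqI_lessThan)
  have L: "emeasure (distr area_measure borel cmod) {x<..} = ennreal (if x < 0 then 1 else if x < 1 then 1 - x\<^sup>2 else 0)" for x
  proof -
    have e: "emeasure (distr area_measure borel cmod) {x<..} = emeasure lborel (unit_disc - cball 0 x) / ennreal pi"
    proof -
      have "cmod -` {x<..} \<in> sets borel"
        by (intro borel_open open_vimage continuous_intros)
      moreover have "unit_disc \<inter> cmod -` {x<..} = unit_disc - cball 0 x" by auto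
      ultimately show ?thesis
        by (simp add: emeasure_distr area_measure_def emeasure_unit_disc)
    qed
    consider "x < 0" | "0 \<le> x" "x < 1" | "1 \<le> x" by linarith
    then show ?thesis
    proof cases
      case 1
      then have "unit_disc - cball 0 x = unit_disc" by auto
      then show ?thesis
        unfolding e using 1 by (simp add: emeasure_unit_disc ennreal_divide_self)
    next
      case 2
      then have "emeasure lborel (unit_disc - cball 0 x) = ennreal pi - ennreal (pi * x\<^sup>2)"
        by (subst emeasure_Diff) (auto simp: emeasure_unit_disc emeasure_cball eval_unit_ball_vol)
      then show ?thesis
        unfolding e using 2 by (simp add: ennreal_minus divide_ennreal abs_square_le_1 diff_divide_distrib)
    next
      case 3
      then have empty: "unit_disc - cball 0 x = {}" by auto
      show ?thesis
        unfolding e empty using 3 by simp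
    qed
  qed
  show "emeasure (distr area_measure borel cmod) {x<..} < \<infinity>" for x
    by (simp add: L)
  show "emeasure (distr area_measure borel cmod) {x<..} =
      emeasure (density lborel (\<lambda>r. ennreal (2 * r) * indicator {0<..<1} r)) {x<..}" for x
  proof -
    \<comment> \<open>Clamping \<open>x\<close> to [0, 1] merges the three cases of \<open>L\<close>
      into the single integral of \<open>2 * r\<close> from \<open>y\<close> to 1.\<close>
    define y where "y = min 1 (max 0 x)"
    have y: "0 \<le> y" "y \<le> 1" by (auto simp: y_def)
    have "emeasure (density lborel (\<lambda>r. ennreal (2 * r) * indicator {0<..<1} r)) {x<..} =
        (\<integral>\<^sup>+r. ennreal (2 * r) * indicator {0<..<1} r * indicator {x<..} r \<partial>lborel)"
      by (subst emeasure_density) auto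
    also have "\<dots> = (\<integral>\<^sup>+r. ennreal (2 * r) * indicator {y..1} r \<partial>lborel)"
      by (intro nn_integral_cong_AE eventually_mono[OF eventually_conj[OF AE_lborel_singleton[of y] AE_lborel_singleton[of 1]]])
         (auto simp: y_def split: split_indicator)
    also have "\<dots> = ennreal (1\<^sup>2 - y\<^sup>2)"
      using y by (intro nn_integral_FTC_Icc[where F = "\<lambda>r. r\<^sup>2"]) (auto intro!: derivative_eq_intros)
    finally show ?thesis
      unfolding L by (auto simp: y_def)
  qed
qed auto

text \<open>No change of variables is made. Averaging \<open>f\<close> over all rotations leaves its
  integral unchanged and produces a function of \<open>cmod u\<close> alone, so the image measure
  under \<open>cmod\<close> finishes the computation.\<close>

lemma nn_integral_area_measure_polar:
  assumes f[measurable]: "f \<in> borel_measurable borel"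
  shows "(\<integral>\<^sup>+u. f u \<partial>area_measure) =
    (\<integral>\<^sup>+r\<in>{0<..<1}. ennreal (2 * r) * (\<integral>\<^sup>+t. f (of_real r * cis t) \<partial>circle_mean) \<partial>lborel)"
proof -
  have cis[measurable]: "cis \<in> borel_measurable borel"
    by (intro borel_measurable_continuous_onI continuous_intros)
  have rot: "(\<integral>\<^sup>+u. f (cis t * u) \<partial>area_measure) = (\<integral>\<^sup>+u. f u \<partial>area_measure)" for t
  proof -
    have m: "(\<lambda>u. f u * indicator unit_disc u) \<in> borel_measurable borel"
      by (intro borel_measurable_times_ennreal borel_measurable_indicator f) simp
    have "(\<integral>\<^sup>+u\<in>unit_disc. f (cis t * u) \<partial>lborel) = (\<integral>\<^sup>+u. f (cis t * u) * indicator unit_disc (cis t * u) \<partial>lborel)"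
      by (intro nn_integral_cong) (auto split: split_indicator simp: norm_mult)
    also have "\<dots> = (\<integral>\<^sup>+u\<in>unit_disc. f u \<partial>lborel)"
      by (rule nn_integral_rotate[OF m]) simp
    finally show ?thesis
      by (simp add: nn_integral_area_measure)
  qed
  have radial: "(\<integral>\<^sup>+t. f (cis t * u) \<partial>circle_mean) = (\<integral>\<^sup>+t. f (of_real (cmod u) * cis t) \<partial>circle_mean)" for u
  proof -
    have u: "u = of_real (cmod u) * cis (Arg2pi u)"
      using Arg2pi_eq[of u] by (simp add: cis_conv_exp)
    have "cis t * u = of_real (cmod u) * cis (t + Arg2pi u)" for t
      by (subst u) (simp add: cis_mult ac_simps flip: cis_mult)
    then have "(\<integral>\<^sup>+t. f (cis t * u) \<partial>circle_mean) = (\<integral>\<^sup>+t. f (of_real (cmod u) * cis (t + Arg2pi u)) \<partial>circle_mean)"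
      by simp
    also have "\<dots> = (\<integral>\<^sup>+t. f (of_real (cmod u) * cis t) \<partial>circle_mean)"
      using Arg2pi_ge_0[of u] Arg2pi_lt_2pi[of u]
      by (intro nn_integral_circle_mean_shift[where f="\<lambda>t. f (of_real (cmod u) * cis t)"]) (auto simp flip: cis_mult)
    finally show ?thesis .
  qed
  have "(\<integral>\<^sup>+u. f u \<partial>area_measure) = (\<integral>\<^sup>+t. (\<integral>\<^sup>+u. f (cis t * u) \<partial>area_measure) \<partial>circle_mean)"
    by (simp add: rot emeasure_circle_mean_UNIV)
  also have "\<dots> = (\<integral>\<^sup>+u. (\<integral>\<^sup>+t. f (cis t * u) \<partial>circle_mean) \<partial>area_measure)"
    by (rule circle_area.Fubini'[symmetric]) measurable
  also have "\<dots> = (\<integral>\<^sup>+u. (\<integral>\<^sup>+t. f (of_real (cmod u) * cis t) \<partial>circle_mean) \<partial>area_measure)"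
    by (simp add: radial)
  also have "\<dots> = (\<integral>\<^sup>+r. (\<integral>\<^sup>+t. f (of_real r * cis t) \<partial>circle_mean) \<partial>distr area_measure borel cmod)"
    by (subst nn_integral_distr) measurable
  also have "\<dots> = (\<integral>\<^sup>+r. ennreal (2 * r) * indicator {0<..<1} r * (\<integral>\<^sup>+t. f (of_real r * cis t) \<partial>circle_mean) \<partial>lborel)"
    unfolding distr_area_measure_cmod by (subst nn_integral_density) measurable
  finally show ?thesis
    by (simp add: ac_simps)
qed

section \<open>Inner functions\<close>

lemma continuous_on_circle:
  assumes "f holomorphic_on unit_disc" "cmod z < 1"
  shows "continuous_on UNIV (\<lambda>t. f (z * cis t))"
proof -
  have "continuous_on UNIV (f \<circ> (\<lambda>t. z * cis t))"
    using assms(2)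
    by (intro continuous_on_compose continuous_intros
        continuous_on_subset[OF holomorphic_on_imp_continuous_on[OF assms(1)]])
       (auto simp: norm_mult)
  then show ?thesis by (simp add: o_def)
qed

lemma nn_integral_circle_mean_continuous:
  assumes "continuous_on UNIV g" "\<And>t. 0 \<le> g t"
  shows "(\<integral>\<^sup>+t. ennreal (g t) \<partial>circle_mean) = ennreal (integral {0..2*pi} g / (2 * pi))"
proof -
  have "continuous_on {0..2*pi} g" by (rule continuous_on_subset[OF assms(1)]) simp
  then have "(g has_integral integral {0..2*pi} g) {0..2*pi}"
    by (intro integrable_integral integrable_continuous_real)
  then have "(\<integral>\<^sup>+t\<in>{0..2*pi}. ennreal (g t) \<partial>lborel) = ennreal (integral {0..2*pi} g)"
    using assms(2) by (intro nn_integral_has_integral_lebesgue')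
  moreover have "0 \<le> integral {0..2*pi} g"
    using assms(2) by (intro integral_nonneg integrable_continuous_real continuous_on_subset[OF assms(1)]) auto
  moreover have "g \<in> borel_measurable borel"
    using assms(1) by (rule borel_measurable_continuous_onI)
  ultimately show ?thesis
    by (subst nn_integral_circle_mean) (simp_all add: divide_ennreal)
qed

text \<open>Cauchy's integral formula on the circle of radius \<open>r\<close>, with
  \<open>r - cmod z\<close> as lower bound of the denominator.\<close>

lemma cmod_le_circle_mean:
  assumes h: "h holomorphic_on unit_disc" and z: "cmod z < r" "r < 1"
  shows "ennreal (cmod (h z)) \<le> ennreal (r / (r - cmod z)) * (\<integral>\<^sup>+t. ennreal (cmod (h (of_real r * cis t))) \<partial>circle_mean)"
proof -
  have r: "0 < r" using z(1) norm_ge_zero[of z] by linarith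
  define g where "g t = cmod (h (of_real r * cis t))" for t
  have contg: "continuous_on UNIV g"
    unfolding g_def using r z by (intro continuous_intros continuous_on_circle[OF h]) auto
  have "((\<lambda>u. h u / (u - z)) has_contour_integral (2 * of_real pi * \<i> * h z)) (circlepath 0 r)"
    using z by (intro Cauchy_integral_circlepath_simple holomorphic_on_subset[OF h]) auto
  then have I: "((\<lambda>t. h (of_real r * cis t) / (of_real r * cis t - z) * r * \<i> * cis t) has_integral (2 * of_real pi * \<i> * h z)) {0..2*pi}"
    unfolding circlepath_def by (subst (asm) has_contour_integral_part_circlepath_iff) auto
  have gi: "g integrable_on {0..2*pi}"
    by (intro integrable_continuous_real continuous_on_subset[OF contg]) auto
  have "cmod (integral {0..2*pi} (\<lambda>t. h (of_real r * cis t) / (of_real r * cis t - z) * r * \<i> * cis t))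
      \<le> integral {0..2*pi} (\<lambda>t. r / (r - cmod z) * g t)"
  proof (rule integral_norm_bound_integral)
    fix t :: real
    have "r - cmod z \<le> cmod (of_real r * cis t - z)"
      using norm_triangle_ineq2[of "of_real r * cis t" z] r by (simp add: norm_mult)
    then have "g t / cmod (of_real r * cis t - z) * r \<le> g t / (r - cmod z) * r"
      using z r by (intro mult_right_mono divide_left_mono mult_pos_pos) (auto simp: g_def)
    then show "cmod (h (of_real r * cis t) / (of_real r * cis t - z) * r * \<i> * cis t) \<le> r / (r - cmod z) * g t"
      using r by (simp add: norm_mult norm_divide g_def mult.commute)
  qed (use I in blast, rule integrable_on_mult_right[OF gi])
  also have "integral {0..2*pi} (\<lambda>t. h (of_real r * cis t) / (of_real r * cis t - z) * r * \<i> * cis t) = 2 * of_real pi * \<i> * h z"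
    using I by (rule integral_unique)
  also have "integral {0..2*pi} (\<lambda>t. r / (r - cmod z) * g t) = r / (r - cmod z) * integral {0..2*pi} g"
    by (rule integral_mult_right)
  finally have "cmod (h z) * (2 * pi) \<le> r / (r - cmod z) * integral {0..2*pi} g"
    by (simp add: norm_mult mult.commute)
  then have "cmod (h z) \<le> r / (r - cmod z) * (integral {0..2*pi} g / (2 * pi))"
    using pi_gt_zero by (subst times_divide_eq_right, subst pos_le_divide_eq) auto
  then have "ennreal (cmod (h z)) \<le> ennreal (r / (r - cmod z)) * ennreal (integral {0..2*pi} g / (2 * pi))"
    using r z by (subst ennreal_mult'[symmetric]) (auto intro: ennreal_leI)
  then show ?thesis
    using nn_integral_circle_mean_continuous[OF contg] by (simp add: g_def)
qed

lemma AE_circle_mean_inner: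
  assumes "inner_function \<Theta>"
  shows "AE t in circle_mean. \<exists>w. has_radial_limit \<Theta> (cis t) w \<and> cmod w = 1"
  using assms unfolding circle_mean_def inner_function_def by (intro AE_uniform_measureI) auto

text \<open>Applying the Cauchy estimate to all powers \<open>\<Theta>\<^sup>n\<close> makes its constant \<open>1 / (1 - \<bar>z\<bar>)\<close> harmless.\<close>
lemma inner_function_norm_le_1:
  assumes inner: "inner_function \<Theta>" and z: "cmod z < 1"
  shows "cmod (\<Theta> z) \<le> 1"
proof -
  have hol: "\<Theta> holomorphic_on unit_disc" and "bounded (\<Theta> ` unit_disc)"
    using inner by (auto simp: inner_function_def H_infinity_def)
  then obtain B where "\<forall>u\<in>unit_disc. cmod (\<Theta> u) \<le> B"
    by (auto simp: bounded_iff)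
  then have B: "cmod (\<Theta> u) \<le> B" if "cmod u < 1" for u
    using that by simp
  \<comment> \<open>Starting the radii at \<open>r0\<close> instead of 0 makes every circle of the
    sequence enclose \<open>z\<close>.\<close>
  obtain r0 where r0: "cmod z < r0" "r0 < 1" using z dense by blast
  define r where "r k = 1 - (1 - r0) * inverse (real (Suc k))" for k
  have r: "cmod z < r k" "0 < r k" "r k < 1" for k
  proof -
    have "(1 - r0) * inverse (real (Suc k)) \<le> (1 - r0) * 1"
      using r0 by (intro mult_left_mono) (auto simp: field_simps)
    then have "r0 \<le> r k" by (simp only: r_def mult_1_right)
    then show "cmod z < r k" using r0 by linarith
    then show "0 < r k" using norm_ge_zero[of z] by linarith
    show "r k < 1" using r0 by (simp add: r_def)
  qed
  have "(\<lambda>k. 1 - (1 - r0) * inverse (real (Suc k))) \<longlonglongrightarrow> 1 - (1 - r0) * 0"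
    by (intro tendsto_intros LIMSEQ_inverse_real_of_nat)
  then have rlim: "r \<longlonglongrightarrow> 1" by (simp add: r_def[abs_def])
  then have rleft: "filterlim r (at_left 1) sequentially"
    using r(3)[THEN less_imp_neq] r(3) by (auto simp: filterlim_at)
  have bound: "cmod (\<Theta> z) ^ n \<le> 1 / (1 - cmod z)" for n
  proof -
    define u where "u k t = ennreal (cmod (\<Theta> (of_real (r k) * cis t)) ^ n)" for k t
    have meas: "u k \<in> borel_measurable circle_mean" for k
    proof -
      have "(\<lambda>t. \<Theta> (of_real (r k) * cis t)) \<in> borel_measurable borel"
        using r[of k] by (intro borel_measurable_continuous_onI continuous_on_circle[OF hol]) auto
      then show ?thesis unfolding u_def by measurable
    qed
    \<comment> \<open>The boundary values enter here: modulus one almost everywhere forces the means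
      of the \<open>n\<close>-th powers to tend to 1, with \<open>B ^ n\<close> as dominating
      constant.\<close>
    have lim: "(\<lambda>k. \<integral>\<^sup>+t. u k t \<partial>circle_mean) \<longlonglongrightarrow> (\<integral>\<^sup>+t. 1 \<partial>circle_mean)"
    proof (rule nn_integral_dominated_convergence)
      show "AE t in circle_mean. u k t \<le> ennreal (B ^ n)" for k
        using r[of k] by (auto simp: u_def norm_mult intro!: AE_I2 ennreal_leI power_mono B)
      show "(\<integral>\<^sup>+t. ennreal (B ^ n) \<partial>circle_mean) < \<infinity>"
        by (simp add: emeasure_circle_mean_UNIV)
      show "AE t in circle_mean. (\<lambda>k. u k t) \<longlonglongrightarrow> 1"
        using AE_circle_mean_inner[OF inner]
      proof (rule eventually_mono)
        fix t assume "\<exists>w. has_radial_limit \<Theta> (cis t) w \<and> cmod w = 1"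
        then obtain w where w: "has_radial_limit \<Theta> (cis t) w" "cmod w = 1" by blast
        have "(\<lambda>k. \<Theta> (of_real (r k) * cis t)) \<longlonglongrightarrow> w"
          using filterlim_compose[OF w(1)[unfolded has_radial_limit_def] rleft] by simp
        then have "(\<lambda>k. u k t) \<longlonglongrightarrow> ennreal (cmod w ^ n)"
          unfolding u_def by (intro tendsto_intros)
        then show "(\<lambda>k. u k t) \<longlonglongrightarrow> 1" using w by simp
      qed
    qed (use meas in auto)
    have "(\<lambda>k. ennreal (r k / (r k - cmod z)) * (\<integral>\<^sup>+t. u k t \<partial>circle_mean)) \<longlonglongrightarrow>
        ennreal (1 / (1 - cmod z)) * (\<integral>\<^sup>+t. 1 \<partial>circle_mean)"
      using z by (intro tendsto_mult_ennreal lim tendsto_intros rlim) (auto simp: emeasure_circle_mean_UNIV)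
    moreover have "ennreal (cmod (\<Theta> z) ^ n) \<le> ennreal (r k / (r k - cmod z)) * (\<integral>\<^sup>+t. u k t \<partial>circle_mean)" for k
      using cmod_le_circle_mean[of "\<lambda>z. \<Theta> z ^ n" z "r k"] hol r[of k]
      by (simp add: u_def norm_power holomorphic_on_power)
    ultimately have "ennreal (cmod (\<Theta> z) ^ n) \<le> ennreal (1 / (1 - cmod z)) * (\<integral>\<^sup>+t. 1 \<partial>circle_mean)"
      by (elim LIMSEQ_le_const) blast
    then show ?thesis
      using z by (simp add: emeasure_circle_mean_UNIV)
  qed
  show ?thesis
  proof (rule ccontr)
    assume "\<not> cmod (\<Theta> z) \<le> 1"
    then obtain n where "1 / (1 - cmod z) < cmod (\<Theta> z) ^ n"
      using real_arch_pow[of "cmod (\<Theta> z)"] by fastforce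
    with bound[of n] show False by linarith
  qed
qed

section \<open>The Schwarz--Pick lemma\<close>

lemma has_field_derivative_Moebius_function_0:
  "(Moebius_function 0 w has_field_derivative 1 - of_real ((cmod w)\<^sup>2)) (at 0)"
  unfolding Moebius_function_def
  by (auto intro!: derivative_eq_intros simp: complex_norm_square[symmetric] mult.commute)

lemma has_field_derivative_Moebius_function_self:
  assumes "cmod w < 1"
  shows "(Moebius_function 0 w has_field_derivative 1 / (1 - of_real ((cmod w)\<^sup>2))) (at w)"
proof -
  have "(cmod w)\<^sup>2 \<noteq> 1" using assms by (simp add: abs_square_eq_1)
  then have "1 - of_real ((cmod w)\<^sup>2) \<noteq> (0 :: complex)"
    by (metis eq_iff_diff_eq_0 of_real_1 of_real_eq_iff)
  then have ne: "1 - cnj w * w \<noteq> 0"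
    by (simp add: complex_norm_square mult.commute del: of_real_power)
  show ?thesis
  proof (rule DERIV_cong)
    have "((\<lambda>z. (z - w) / (1 - cnj w * z)) has_field_derivative
        ((1 - 0) * (1 - cnj w * w) - (w - w) * (0 - cnj w * 1)) / ((1 - cnj w * w) * (1 - cnj w * w))) (at w)"
      by (intro DERIV_divide DERIV_diff DERIV_ident DERIV_const DERIV_cmult ne)
    then show "(Moebius_function 0 w has_field_derivative
        ((1 - 0) * (1 - cnj w * w) - (w - w) * (0 - cnj w * 1)) / ((1 - cnj w * w) * (1 - cnj w * w))) (at w)"
      by (simp add: Moebius_function_def)
  qed (use ne in \<open>simp add: complex_norm_square mult.commute del: of_real_power\<close>)
qed

text \<open>Composing with the disc automorphisms that send 0 to \<open>a\<close> and
  \<open>f a\<close> to 0 reduces the claim to Schwarz's lemma at 0; the derivatives of these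
  automorphisms supply the factors \<open>1 - (cmod a)^2\<close> and
  \<open>1 / (1 - (cmod (f a))^2)\<close>.\<close>

lemma Schwarz_Pick:
  assumes hol: "f holomorphic_on unit_disc" and le: "\<And>z. cmod z < 1 \<Longrightarrow> cmod (f z) \<le> 1" and a: "cmod a < 1"
  shows "cmod (deriv f a) * (1 - (cmod a)\<^sup>2) \<le> 1 - (cmod (f a))\<^sup>2"
proof (cases "\<forall>z\<in>unit_disc. cmod (f z) < 1")
  case True
  define b where "b = f a"
  have b: "cmod b < 1" using True a by (simp add: b_def)
  define g where "g = Moebius_function 0 b \<circ> (f \<circ> Moebius_function 0 (- a))"
  have maps: "Moebius_function 0 (- a) ` unit_disc \<subseteq> unit_disc" "f ` unit_disc \<subseteq> unit_disc"
    using a True by (auto intro!: Moebius_function_norm_lt_1)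
  have holg: "g holomorphic_on unit_disc"
    unfolding g_def using a b maps
    by (intro holomorphic_on_compose_gen[where t = unit_disc] holomorphic_on_compose_gen[OF _ hol] Moebius_function_holomorphic) auto
  have m0: "Moebius_function 0 (- a) 0 = a" by (simp add: Moebius_function_of_zero)
  have deriv_le: "cmod (deriv g 0) \<le> 1"
  proof (rule Schwarz_Lemma(2)[OF holg, of 0])
    show "g 0 = 0" by (simp add: g_def m0 b_def Moebius_function_eq_zero)
    show "cmod (g z) < 1" if "cmod z < 1" for z
    proof -
      have "Moebius_function 0 (- a) z \<in> unit_disc"
        using maps(1) that by (auto simp: image_subset_iff)
      then have "cmod (f (Moebius_function 0 (- a) z)) < 1" using True by blast
      then show ?thesis using b by (simp add: g_def Moebius_function_norm_lt_1)
    qed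
  qed simp
  have deriv_eq: "deriv g 0 = 1 / (1 - of_real ((cmod b)\<^sup>2)) * (deriv f a * (1 - of_real ((cmod a)\<^sup>2)))"
  proof (rule DERIV_imp_deriv)
    have "(f has_field_derivative deriv f a) (at (Moebius_function 0 (- a) 0))"
      unfolding m0 using hol a by (intro holomorphic_derivI[of f unit_disc]) auto
    then have inner: "(f \<circ> Moebius_function 0 (- a) has_field_derivative deriv f a * (1 - of_real ((cmod a)\<^sup>2))) (at 0)"
      using has_field_derivative_Moebius_function_0[of "- a"] by (intro DERIV_chain) auto
    have "(Moebius_function 0 b has_field_derivative 1 / (1 - of_real ((cmod b)\<^sup>2)))
        (at ((f \<circ> Moebius_function 0 (- a)) 0))"
      using has_field_derivative_Moebius_function_self[OF b] by (simp add: m0 b_def)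
    then show "(g has_field_derivative 1 / (1 - of_real ((cmod b)\<^sup>2)) * (deriv f a * (1 - of_real ((cmod a)\<^sup>2)))) (at 0)"
      unfolding g_def by (rule DERIV_chain[OF _ inner])
  qed
  have norm_eq: "cmod (1 - of_real ((cmod w)\<^sup>2)) = 1 - (cmod w)\<^sup>2" if "cmod w < 1" for w
  proof -
    have "(cmod w)\<^sup>2 \<le> 1" using that by (simp add: abs_square_le_1)
    moreover have "1 - complex_of_real ((cmod w)\<^sup>2) = of_real (1 - (cmod w)\<^sup>2)" by simp
    ultimately show ?thesis by (simp only: norm_of_real)
  qed
  have "1 / (1 - (cmod b)\<^sup>2) * (cmod (deriv f a) * (1 - (cmod a)\<^sup>2)) \<le> 1"
    using deriv_le by (simp only: deriv_eq norm_mult norm_divide norm_one norm_eq[OF a] norm_eq[OF b])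
  moreover have "(cmod b)\<^sup>2 < 1" using b by (simp add: abs_square_less_1)
  ultimately show ?thesis
    by (simp add: b_def pos_divide_le_eq)
next
  case False
  then obtain z where z: "z \<in> unit_disc" "1 \<le> cmod (f z)" by auto
  have "f constant_on unit_disc"
    using le z by (intro maximum_modulus_principle[OF hol _ _ _ order_refl, of z]) (auto intro: order_trans)
  then obtain c where c: "\<And>u. u \<in> unit_disc \<Longrightarrow> f u = c" by (auto simp: constant_on_def)
  have "(f has_field_derivative 0) (at a)"
    by (rule has_field_derivative_transform_within_open[where f = "\<lambda>_. c" and S = unit_disc]) (use a c in auto)
  then have "deriv f a = 0" by (rule DERIV_imp_deriv)
  then show ?thesis using le[OF a] by (simp add: abs_square_le_1)
qed

section \<open>Growth along a radius\<close>

text \<open>The fundamental theorem of calculus is applied on compact segments up to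
  \<open>\<rho> < 1\<close>, as nothing is known about \<open>deriv f\<close> at the boundary; the
  bound does not depend on \<open>\<rho>\<close>, so it survives the radial limit. In
  \<open>ennreal\<close> a negative left side becomes 0 and the right side may be infinite.\<close>

lemma radial_increment_le:
  assumes hol: "f holomorphic_on unit_disc" and \<zeta>: "cmod \<zeta> = 1" and w: "has_radial_limit f \<zeta> w" and r: "0 \<le> r" "r < 1"
  shows "ennreal (cmod w - cmod (f (of_real r * \<zeta>))) \<le> (\<integral>\<^sup>+s\<in>{r<..<1}. ennreal (cmod (deriv f (of_real s * \<zeta>))) \<partial>lborel)"
proof -
  define D where "D s = cmod (deriv f (of_real s * \<zeta>))" for s
  define J where "J = (\<integral>\<^sup>+s\<in>{r<..<1}. ennreal (D s) \<partial>lborel)"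
  have bound: "ennreal (cmod (f (of_real \<rho> * \<zeta>)) - cmod (f (of_real r * \<zeta>))) \<le> J" if \<rho>: "r < \<rho>" "\<rho> < 1" for \<rho>
  proof -
    have in_disc: "of_real s * \<zeta> \<in> unit_disc" if "s \<in> {r..\<rho>}" for s
      using that r \<rho> \<zeta> by (auto simp: norm_mult)
    have cont: "continuous_on {r..\<rho>} (\<lambda>s. deriv f (of_real s * \<zeta>))"
    proof -
      have "continuous_on {r..\<rho>} (deriv f \<circ> (\<lambda>s. of_real s * \<zeta>))"
        using in_disc
        by (intro continuous_on_compose continuous_intros
            continuous_on_subset[OF holomorphic_on_imp_continuous_on[OF holomorphic_deriv[OF hol]]]) auto
      then show ?thesis by (simp add: o_def)
    qed
    have I: "((\<lambda>s. \<zeta> * deriv f (of_real s * \<zeta>)) has_integral (f (of_real \<rho> * \<zeta>) - f (of_real r * \<zeta>))) {r..\<rho>}"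
    proof (rule fundamental_theorem_of_calculus)
      fix s assume s: "s \<in> {r..\<rho>}"
      have "(f has_field_derivative deriv f (of_real s * \<zeta>)) (at (of_real s * \<zeta>))"
        using hol in_disc[OF s] by (intro holomorphic_derivI[of f unit_disc]) auto
      moreover have "((\<lambda>s. of_real s * \<zeta>) has_vector_derivative \<zeta>) (at s within {r..\<rho>})"
        by (auto intro!: derivative_eq_intros)
      ultimately show "((\<lambda>s. f (of_real s * \<zeta>)) has_vector_derivative \<zeta> * deriv f (of_real s * \<zeta>)) (at s within {r..\<rho>})"
        using field_vector_diff_chain_within[of "\<lambda>s. of_real s * \<zeta>" \<zeta> s "{r..\<rho>}" f "deriv f (of_real s * \<zeta>)"]
        by (auto simp: o_def intro: has_field_derivative_at_within)
    qed (use \<rho> in simp)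
    have Di: "D integrable_on {r..\<rho>}"
      unfolding D_def by (intro integrable_continuous_real continuous_intros cont)
    have "cmod (f (of_real \<rho> * \<zeta>)) - cmod (f (of_real r * \<zeta>)) \<le> cmod (f (of_real \<rho> * \<zeta>) - f (of_real r * \<zeta>))"
      by (rule norm_triangle_ineq2)
    also have "\<dots> \<le> integral {r..\<rho>} D"
      unfolding integral_unique[OF I, symmetric]
      by (rule integral_norm_bound_integral) (use I Di \<zeta> in \<open>auto simp: norm_mult D_def\<close>)
    finally have "ennreal (cmod (f (of_real \<rho> * \<zeta>)) - cmod (f (of_real r * \<zeta>))) \<le> ennreal (integral {r..\<rho>} D)"
      by (rule ennreal_leI)
    also have "\<dots> = (\<integral>\<^sup>+s\<in>{r..\<rho>}. ennreal (D s) \<partial>lborel)"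
      using Di unfolding D_def
      by (intro nn_integral_has_integral_lebesgue'[symmetric] integrable_integral) auto
    also have "\<dots> \<le> J"
      unfolding J_def using \<rho>
      by (intro nn_integral_mono_AE eventually_mono[OF AE_lborel_singleton[of r]]) (auto split: split_indicator)
    finally show ?thesis .
  qed
  have "((\<lambda>\<rho>. ennreal (cmod (f (of_real \<rho> * \<zeta>)) - cmod (f (of_real r * \<zeta>)))) \<longlongrightarrow>
      ennreal (cmod w - cmod (f (of_real r * \<zeta>)))) (at_left 1)"
    using w unfolding has_radial_limit_def by (intro tendsto_intros)
  moreover have "\<forall>\<^sub>F \<rho> in at_left 1. ennreal (cmod (f (of_real \<rho> * \<zeta>)) - cmod (f (of_real r * \<zeta>))) \<le> J"
    using eventually_at_left_real[OF r(2)] by (rule eventually_mono) (use bound in auto)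
  ultimately have "ennreal (cmod w - cmod (f (of_real r * \<zeta>))) \<le> J"
    by (rule tendsto_upperbound) simp
  then show ?thesis by (simp add: J_def D_def)
qed

section \<open>Monotonicity of integral means\<close>

text \<open>The value at \<open>w\<close> has modulus \<open>cmod w powr (p - 1)\<close>, which
  tends to 0 at the origin for every \<open>p > 1\<close>, although the real factor is unbounded
  there when \<open>p < 2\<close>.\<close>

lemma continuous_on_duality_map:
  assumes "1 < p"
  shows "continuous_on UNIV (\<lambda>w. cnj w * of_real (cmod w powr (p - 2)))"
  unfolding continuous_on_eq_continuous_within
proof
  fix w :: complex
  show "continuous (at w within UNIV) (\<lambda>w. cnj w * of_real (cmod w powr (p - 2)))"
  proof (cases "w = 0")
    case True
    have "((\<lambda>w. cmod w powr (p - 1)) \<longlongrightarrow> cmod (0 :: complex) powr (p - 1)) (at 0)"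
      using assms by (intro tendsto_powr2 tendsto_intros) auto
    then have "((\<lambda>w. cmod w powr (p - 1)) \<longlongrightarrow> 0) (at (0 :: complex))"
      using assms by simp
    moreover have "cmod w powr (p - 1) = cmod (cnj w * of_real (cmod w powr (p - 2)))" for w
      by (cases "w = 0") (simp_all add: norm_mult powr_mult_base)
    ultimately have "((\<lambda>w. cnj w * of_real (cmod w powr (p - 2))) \<longlongrightarrow> 0) (at (0 :: complex))"
      by (simp add: tendsto_norm_zero_iff)
    then show ?thesis by (simp add: True continuous_within)
  next
    case False
    then show ?thesis by (intro continuous_intros) auto
  qed
qed

text \<open>
  Pairing \<open>h\<close> on circles with the dual function of its restriction to the circle of radius \<open>s\<close> gives
  a holomorphic function \<open>\<phi>\<close> whose value at \<open>s\<close> is the mean over that circle; the maximum principle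
  for \<open>\<phi>\<close> together with Young's inequality then replaces subharmonicity of \<open>\<bar>h\<bar>\<^sup>p\<close>.
\<close>
lemma circle_mean_powr_mono:
  assumes hol: "h holomorphic_on unit_disc" and p: "1 < p" and s: "0 \<le> s" "s \<le> r" and r: "r < 1"
  shows "(\<integral>\<^sup>+t. ennreal (cmod (h (of_real s * cis t)) powr p) \<partial>circle_mean) \<le>
    (\<integral>\<^sup>+t. ennreal (cmod (h (of_real r * cis t)) powr p) \<partial>circle_mean)"
proof (cases "s = r")
  case False
  with s have sr: "s < r" "0 < r" by auto
  define M where "M z = integral {0..2*pi} (\<lambda>t. cmod (h (z * cis t)) powr p)" for z
  have cont: "continuous_on UNIV (\<lambda>t. cmod (h (z * cis t)) powr p)" if "cmod z < 1" for z
    using continuous_on_circle[OF hol that] p by (intro continuous_on_powr' continuous_intros) auto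
  have int: "(\<lambda>t. cmod (h (z * cis t)) powr p) integrable_on {0..2*pi}" if "cmod z < 1" for z
    by (intro integrable_continuous_real continuous_on_subset[OF cont[OF that]]) simp
  have nn: "(\<integral>\<^sup>+t. ennreal (cmod (h (z * cis t)) powr p) \<partial>circle_mean) = ennreal (M z / (2 * pi))" if "cmod z < 1" for z
    unfolding M_def by (rule nn_integral_circle_mean_continuous[OF cont[OF that]]) simp
  have M_nonneg: "0 \<le> M z" if "cmod z < 1" for z
    unfolding M_def by (rule integral_nonneg[OF int[OF that]]) simp
  \<comment> \<open>Needed because the maximum principle compares with all points of a circle, not
    only with the positive radius.\<close>
  have M_rot: "M z = M (of_real (cmod z))" if "cmod z < 1" for z
  proof -
    have z: "z = of_real (cmod z) * cis (Arg2pi z)"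
      using Arg2pi_eq[of z] by (simp add: cis_conv_exp)
    have [measurable]: "(\<lambda>t. h (of_real (cmod z) * cis t)) \<in> borel_measurable borel"
      using that by (intro borel_measurable_continuous_onI continuous_on_circle[OF hol]) simp
    have "z * cis t = of_real (cmod z) * cis (t + Arg2pi z)" for t
      by (subst z) (simp add: ac_simps flip: cis_mult)
    then have "ennreal (M z / (2 * pi)) = (\<integral>\<^sup>+t. ennreal (cmod (h (of_real (cmod z) * cis (t + Arg2pi z))) powr p) \<partial>circle_mean)"
      using nn[OF that] by simp
    also have "\<dots> = (\<integral>\<^sup>+t. ennreal (cmod (h (of_real (cmod z) * cis t)) powr p) \<partial>circle_mean)"
      using Arg2pi_ge_0[of z] Arg2pi_lt_2pi[of z]
      by (intro nn_integral_circle_mean_shift[where f = "\<lambda>t. ennreal (cmod (h (of_real (cmod z) * cis t)) powr p)"])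
         (auto simp flip: cis_mult)
    also have "\<dots> = ennreal (M (of_real (cmod z)) / (2 * pi))"
      using that by (intro nn) simp
    finally show ?thesis
      using M_nonneg[OF that] M_nonneg[of "of_real (cmod z)"] that by simp
  qed
  \<comment> \<open>On the circle of radius \<open>s\<close> the product of \<open>h\<close> and
    \<open>k\<close> is the \<open>p\<close>-th power of the modulus of \<open>h\<close>, and so is
    \<open>cmod (k t) powr q\<close> for the conjugate exponent \<open>q\<close>.\<close>
  define k where "k t = cnj (h (of_real s * cis t)) * of_real (cmod (h (of_real s * cis t)) powr (p - 2))" for t
  have contk: "continuous_on A k" for A
  proof -
    have "continuous_on UNIV ((\<lambda>w. cnj w * of_real (cmod w powr (p - 2))) \<circ> (\<lambda>t. h (of_real s * cis t)))"
      using s r by (intro continuous_on_compose continuous_on_circle[OF hol] continuous_on_subset[OF continuous_on_duality_map[OF p]]) auto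
    then show ?thesis by (auto simp: k_def o_def intro: continuous_on_subset)
  qed
  define \<phi> where "\<phi> z = integral {0..2*pi} (\<lambda>t. h (z * cis t) * k t)" for z
  have conth: "continuous_on A (\<lambda>t. h (z * cis t))" if "cmod z < 1" for z A
    using continuous_on_circle[OF hol that] by (rule continuous_on_subset) simp
  \<comment> \<open>\<open>k\<close> does not depend on \<open>z\<close>, so \<open>z\<close> enters
    only through the holomorphic factor and one may differentiate under the integral.\<close>
  have hol_\<phi>: "\<phi> holomorphic_on unit_disc"
  proof -
    have "(\<lambda>z. integral (cbox 0 (2 * pi)) (\<lambda>t. h (z * cis t) * k t)) holomorphic_on unit_disc"
    proof (rule leibniz_rule_holomorphic[where fx = "\<lambda>z t. deriv h (z * cis t) * cis t * k t"])
      fix z t assume z: "z \<in> unit_disc"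
      have "(h has_field_derivative deriv h (z * cis t)) (at (z * cis t))"
        using z hol by (intro holomorphic_derivI[of h unit_disc]) (auto simp: norm_mult)
      then have "((\<lambda>z. h (z * cis t)) has_field_derivative deriv h (z * cis t) * cis t) (at z)"
        by (rule DERIV_chain2) (auto intro!: derivative_eq_intros)
      then show "((\<lambda>z. h (z * cis t) * k t) has_field_derivative deriv h (z * cis t) * cis t * k t) (at z within unit_disc)"
        by (rule has_field_derivative_at_within[OF DERIV_cmult_right])
    next
      fix z assume "z \<in> unit_disc"
      then show "(\<lambda>t. h (z * cis t) * k t) integrable_on cbox 0 (2 * pi)"
        by (intro integrable_continuous continuous_intros conth contk) simp
    next
      have "continuous_on (unit_disc \<times> cbox 0 (2*pi)) (deriv h \<circ> (\<lambda>(z, t). z * cis t))"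
        by (intro continuous_on_compose continuous_on_subset[OF holomorphic_on_imp_continuous_on[OF holomorphic_deriv[OF hol]]])
           (auto simp: norm_mult split_beta intro!: continuous_intros)
      moreover have "continuous_on (unit_disc \<times> cbox 0 (2*pi)) (k \<circ> snd)"
        by (intro continuous_on_compose continuous_intros contk)
      ultimately show "continuous_on (unit_disc \<times> cbox 0 (2*pi)) (\<lambda>(z, t). deriv h (z * cis t) * cis t * k t)"
        by (auto simp: split_beta o_def intro!: continuous_intros)
    qed simp
    then show ?thesis by (simp add: \<phi>_def[abs_def])
  qed
  have \<phi>_s: "\<phi> (of_real s) = of_real (M (of_real s))"
  proof -
    have "h (of_real s * cis t) * k t = of_real (cmod (h (of_real s * cis t)) powr p)" for t
    proof (cases "h (of_real s * cis t) = 0")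
      case False
      then have "cmod (h (of_real s * cis t)) powr p = (cmod (h (of_real s * cis t)))\<^sup>2 * cmod (h (of_real s * cis t)) powr (p - 2)"
        by (simp add: powr_diff)
      then show ?thesis
        by (simp only: k_def mult.assoc[symmetric] complex_norm_square[symmetric] of_real_mult)
    qed simp
    moreover have "((\<lambda>t. of_real (cmod (h (of_real s * cis t)) powr p) :: complex) has_integral of_real (M (of_real s))) {0..2*pi}"
      unfolding M_def using s r by (intro has_integral_of_real integrable_integral int) auto
    ultimately show ?thesis
      by (simp add: \<phi>_def integral_unique)
  qed
  define q where "q = p / (p - 1)"
  have q: "1 < q" "1 / p + 1 / q = 1" "(p - 1) * q = p" using p by (auto simp: q_def field_simps)
  have \<phi>_le: "cmod (\<phi> z) \<le> M (of_real (cmod z)) / p + M (of_real s) / q" if z: "cmod z < 1" for z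
  proof -
    have norm_k: "cmod (k t) powr q = cmod (h (of_real s * cis t)) powr p" for t
    proof -
      have "cmod (k t) = cmod (h (of_real s * cis t)) powr (p - 1)"
        by (cases "h (of_real s * cis t) = 0") (simp_all add: k_def norm_mult powr_mult_base)
      then show ?thesis using q by (simp add: powr_powr)
    qed
    have ints: "(\<lambda>t. cmod (h (z * cis t)) powr p / p) integrable_on {0..2*pi}"
      "(\<lambda>t. cmod (h (of_real s * cis t)) powr p / q) integrable_on {0..2*pi}"
      using int[OF z] int[of "of_real s"] s r by (auto intro: integrable_on_divide)
    have "cmod (\<phi> z) \<le> integral {0..2*pi} (\<lambda>t. cmod (h (z * cis t)) powr p / p + cmod (h (of_real s * cis t)) powr p / q)"
      unfolding \<phi>_def
    proof (rule integral_norm_bound_integral)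
      show "(\<lambda>t. h (z * cis t) * k t) integrable_on {0..2*pi}"
        using z by (intro integrable_continuous_real continuous_intros conth contk)
      show "(\<lambda>t. cmod (h (z * cis t)) powr p / p + cmod (h (of_real s * cis t)) powr p / q) integrable_on {0..2*pi}"
        by (intro integrable_add ints)
      show "cmod (h (z * cis t) * k t) \<le> cmod (h (z * cis t)) powr p / p + cmod (h (of_real s * cis t)) powr p / q" for t
        using Youngs_inequality[OF p q(1,2), of "cmod (h (z * cis t))" "cmod (k t)"] by (simp add: norm_mult norm_k)
    qed
    also have "\<dots> = M z / p + M (of_real s) / q"
      using ints by (simp add: Henstock_Kurzweil_Integration.integral_add M_def)
    finally show ?thesis using M_rot[OF z] by simp
  qed
  \<comment> \<open>On the circle of radius \<open>r\<close> the bound \<open>\<phi>_le\<close> is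
    constant, so the maximum principle carries it to the interior point \<open>s\<close>.\<close>
  have "cmod (\<phi> (of_real s)) \<le> M (of_real r) / p + M (of_real s) / q"
  proof (rule maximum_modulus_frontier[of \<phi> "cball 0 r"])
    show "\<phi> holomorphic_on interior (cball 0 r)"
      using r by (intro holomorphic_on_subset[OF hol_\<phi>]) auto
    show "continuous_on (closure (cball 0 r)) \<phi>"
      using r by (intro holomorphic_on_imp_continuous_on holomorphic_on_subset[OF hol_\<phi>]) auto
    show "cmod (\<phi> z) \<le> M (of_real r) / p + M (of_real s) / q" if "z \<in> frontier (cball 0 r)" for z
      using \<phi>_le[of z] that sr r by auto
  qed (use s in auto)
  \<comment> \<open>Young's inequality leaves \<open>M (of_real s)\<close> on the right as well;
    being a real number with coefficient \<open>1 / q < 1\<close>, it is absorbed into the left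
    side.\<close>
  then have "M (of_real s) \<le> M (of_real r) / p + M (of_real s) / q"
    using M_nonneg[of "of_real s"] s r by (simp add: \<phi>_s)
  moreover have "M (of_real s) = M (of_real s) / p + M (of_real s) / q"
    using q(2) by (metis distrib_left mult.right_neutral times_divide_eq_right)
  ultimately have "M (of_real s) / p \<le> M (of_real r) / p" by linarith
  then have "M (of_real s) \<le> M (of_real r)"
    using p by (simp add: divide_le_cancel)
  then show ?thesis
    using nn[of "of_real s"] nn[of "of_real r"] s r sr by (auto intro!: ennreal_leI divide_right_mono)
qed simp

section \<open>Hardy's inequality\<close>

text \<open>The convex function \<open>u powr p\<close> lies above its tangent at \<open>m\<close>.
  Obtaining this from Young's inequality for \<open>u\<close> and \<open>m powr (p - 1)\<close>
  covers \<open>m = 0\<close> without a separate case.\<close>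

lemma powr_tangent_le:
  fixes u m p :: real
  assumes "1 < p" "0 \<le> u" "0 \<le> m"
  shows "p * m powr (p - 1) * u \<le> u powr p + (p - 1) * m powr p"
proof -
  have q: "1 < p / (p - 1)" "1 / p + 1 / (p / (p - 1)) = 1"
    using assms(1) by (simp_all add: field_simps)
  have "u * m powr (p - 1) \<le> u powr p / p + (m powr (p - 1)) powr (p / (p - 1)) / (p / (p - 1))"
    using assms q by (intro Youngs_inequality) auto
  also have "(m powr (p - 1)) powr (p / (p - 1)) = m powr p"
    using assms by (simp add: powr_powr)
  finally show ?thesis
    using assms(1) by (simp add: field_simps)
qed

lemma nn_integral_powr_from_0:
  fixes a c :: real
  assumes "-1 < a" "0 \<le> c"
  shows "(\<integral>\<^sup>+x\<in>{0<..<c}. ennreal (x powr a) \<partial>lborel) = ennreal (c powr (a + 1) / (a + 1))"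
proof -
  have "(\<integral>\<^sup>+x\<in>{0<..<c}. ennreal (x powr a) \<partial>lborel) = (\<integral>\<^sup>+x\<in>{0..c}. ennreal (x powr a) \<partial>lborel)"
    by (intro nn_integral_cong_AE eventually_mono[OF eventually_conj[OF AE_lborel_singleton[of 0] AE_lborel_singleton[of c]]])
       (auto split: split_indicator)
  also have "\<dots> = ennreal (c powr (a + 1) / (a + 1))"
    using has_integral_powr_from_0[OF assms] by (intro nn_integral_has_integral_lebesgue') auto
  finally show ?thesis .
qed

lemma nn_integral_powr_tail_le:
  fixes a c :: real
  assumes "a < -1" "0 < c"
  shows "(\<integral>\<^sup>+x\<in>{c<..}. ennreal (x powr a) \<partial>lborel) \<le> ennreal (c powr (a + 1) / (- a - 1))"
proof -
  have "(\<integral>\<^sup>+x\<in>{c<..}. ennreal (x powr a) \<partial>lborel) \<le> (\<integral>\<^sup>+x\<in>{c..}. ennreal (x powr a) \<partial>lborel)"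
    by (intro nn_integral_mono) (auto split: split_indicator)
  also have "\<dots> = ennreal (- (c powr (a + 1)) / (a + 1))"
    using has_integral_powr_to_inf[OF assms] by (intro nn_integral_has_integral_lebesgue') auto
  also have "- (c powr (a + 1)) / (a + 1) = c powr (a + 1) / (- a - 1)"
    using assms by (simp add: field_simps)
  finally show ?thesis by simp
qed

text \<open>
  Jensen's inequality for the density \<open>y powr (\<gamma> - 1)\<close>, via tangent lines; stated for a real lower
  bound \<open>a\<close> because the integral of \<open>g\<close> itself may be infinite.
\<close>
lemma powr_le_nn_integral:
  fixes p \<gamma> x a :: real
  assumes p: "1 < p" and \<gamma>: "0 < \<gamma>" and x: "0 < x" and a: "0 \<le> a"
    and [measurable]: "g \<in> borel_measurable borel" and g: "\<And>y. 0 \<le> g y"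
    and le: "ennreal a \<le> (\<integral>\<^sup>+y\<in>{0<..<x}. ennreal (g y) \<partial>lborel)"
  shows "ennreal (a powr p) \<le> ennreal (x powr (\<gamma> * (p - 1)) / \<gamma> powr (p - 1)) *
    (\<integral>\<^sup>+y\<in>{0<..<x}. ennreal (y powr ((1 - \<gamma>) * (p - 1)) * g y powr p) \<partial>lborel)"
proof -
  \<comment> \<open>\<open>Z\<close> is the mass of the density \<open>y powr (\<gamma> - 1)\<close>
    on (0, x). Hence \<open>m = a / Z\<close> is a lower bound for the mean of
    \<open>g y * y powr (1 - \<gamma>)\<close>, and the tangent is taken at this point.\<close>
  define Z where "Z = x powr \<gamma> / \<gamma>"
  define J where "J = (\<integral>\<^sup>+y\<in>{0<..<x}. ennreal (y powr ((1 - \<gamma>) * (p - 1)) * g y powr p) \<partial>lborel)"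
  have Z: "0 < Z" using x \<gamma> by (simp add: Z_def)
  define m where "m = a / Z"
  have m: "0 \<le> m" using a Z by (simp add: m_def)
  have point: "p * m powr (p - 1) * g y \<le> y powr ((1 - \<gamma>) * (p - 1)) * g y powr p + (p - 1) * m powr p * y powr (\<gamma> - 1)"
    if y: "0 < y" for y
  proof -
    have "p * m powr (p - 1) * (g y * y powr (1 - \<gamma>)) \<le> (g y * y powr (1 - \<gamma>)) powr p + (p - 1) * m powr p"
      using p m g by (intro powr_tangent_le) auto
    then have "p * m powr (p - 1) * (g y * y powr (1 - \<gamma>)) * y powr (\<gamma> - 1) \<le>
        ((g y * y powr (1 - \<gamma>)) powr p + (p - 1) * m powr p) * y powr (\<gamma> - 1)"
      by (rule mult_right_mono) simp
    moreover have "y powr (1 - \<gamma>) * y powr (\<gamma> - 1) = 1"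
      using y by (simp flip: powr_add)
    moreover have "(g y * y powr (1 - \<gamma>)) powr p * y powr (\<gamma> - 1) = y powr ((1 - \<gamma>) * (p - 1)) * g y powr p"
      using y g[of y] by (simp add: powr_mult powr_powr algebra_simps flip: powr_add)
    ultimately show ?thesis
      by (simp add: distrib_right mult.assoc)
  qed
  have "ennreal (p * m powr (p - 1) * a) = ennreal (p * m powr (p - 1)) * ennreal a"
    using p by (simp add: ennreal_mult' ennreal_mult'')
  also have "\<dots> \<le> ennreal (p * m powr (p - 1)) * (\<integral>\<^sup>+y\<in>{0<..<x}. ennreal (g y) \<partial>lborel)"
    by (intro mult_left_mono le) simp
  also have "\<dots> = (\<integral>\<^sup>+y\<in>{0<..<x}. ennreal (p * m powr (p - 1) * g y) \<partial>lborel)"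
    using p g by (subst nn_integral_cmult[symmetric]) (auto simp: ennreal_mult' mult.assoc)
  also have "\<dots> \<le> (\<integral>\<^sup>+y. ennreal (y powr ((1 - \<gamma>) * (p - 1)) * g y powr p) * indicator {0<..<x} y +
      ennreal ((p - 1) * m powr p) * (ennreal (y powr (\<gamma> - 1)) * indicator {0<..<x} y) \<partial>lborel)"
    using p g point
    by (intro nn_integral_mono)
       (auto split: split_indicator simp flip: ennreal_plus ennreal_mult'' intro!: ennreal_leI)
  also have "\<dots> = J + ennreal ((p - 1) * m powr p) * ennreal Z"
    using nn_integral_powr_from_0[of "\<gamma> - 1" x] \<gamma> x
    by (subst nn_integral_add) (auto simp: nn_integral_cmult J_def Z_def)
  also have "\<dots> = J + ennreal ((p - 1) * m powr p * Z)"
    using Z p by (simp add: ennreal_mult'')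
  \<comment> \<open>Since \<open>a = m * Z\<close>, the left side is
    \<open>p * m powr p * Z\<close>; it is split so that the finite second summand cancels even if
    \<open>J\<close> is infinite.\<close>
  also have "p * m powr (p - 1) * a = m powr p * Z + (p - 1) * m powr p * Z"
  proof -
    have "m powr (p - 1) * m = m powr p"
      using m by (cases "m = 0") (auto simp: powr_diff)
    moreover have "a = m * Z" using Z by (simp add: m_def)
    ultimately have "p * m powr (p - 1) * a = p * (m powr p * Z)" by (simp add: ac_simps)
    then show ?thesis by (simp add: algebra_simps)
  qed
  finally have "ennreal (m powr p * Z) + ennreal ((p - 1) * m powr p * Z) \<le> J + ennreal ((p - 1) * m powr p * Z)"
    using p Z by simp
  then have J: "ennreal (m powr p * Z) \<le> J"
    by (simp add: ennreal_add_left_cancel_le add.commute)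
  have "a powr p = Z powr (p - 1) * (m powr p * Z)"
    using a Z by (simp add: m_def powr_divide powr_diff)
  then have "ennreal (a powr p) = ennreal (Z powr (p - 1)) * ennreal (m powr p * Z)"
    using Z by (simp add: ennreal_mult'')
  also have "\<dots> \<le> ennreal (Z powr (p - 1)) * J"
    by (intro mult_left_mono J) simp
  also have "Z powr (p - 1) = x powr (\<gamma> * (p - 1)) / \<gamma> powr (p - 1)"
    using x \<gamma> by (simp add: Z_def powr_divide powr_powr)
  finally show ?thesis by (simp add: J_def)
qed

text \<open>The weighted Jensen bound at each \<open>x\<close> is integrated and the order
  exchanged, which leaves a tail integral of a pure power over \<open>x > y\<close>. Only an upper
  bound on \<open>a\<close> is assumed, because \<open>1 - cmod (\<Theta> u)\<close> is merely
  dominated by a radial integral.\<close>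

lemma hardy_inequality:
  fixes p \<alpha> :: real
  assumes p: "1 < p" and \<alpha>: "\<alpha> < p - 1"
    and [measurable]: "a \<in> borel_measurable borel" "g \<in> borel_measurable borel"
    and a: "\<And>x. 0 \<le> a x" and g: "\<And>y. 0 \<le> g y"
    and le: "\<And>x. 0 < x \<Longrightarrow> x < b \<Longrightarrow> ennreal (a x) \<le> (\<integral>\<^sup>+y\<in>{0<..<x}. ennreal (g y) \<partial>lborel)"
  shows "(\<integral>\<^sup>+x\<in>{0<..<b}. ennreal (x powr (\<alpha> - p) * a x powr p) \<partial>lborel) \<le>
    ennreal ((p / (p - 1 - \<alpha>)) powr p) * (\<integral>\<^sup>+y\<in>{0<..<b}. ennreal (y powr \<alpha> * g y powr p) \<partial>lborel)"
proof -
  \<comment> \<open>A general exponent gives the constant \<open>1 / (\<gamma> powr (p - 1) * (p - 1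
    - \<alpha> - \<gamma> * (p - 1)))\<close>; this choice minimizes it, and both factors of the
    denominator then combine to \<open>\<gamma> powr p\<close>.\<close>
  define \<gamma> where "\<gamma> = (p - 1 - \<alpha>) / p"
  have \<gamma>: "0 < \<gamma>" and p\<gamma>: "p * \<gamma> = p - 1 - \<alpha>" using p \<alpha> by (auto simp: \<gamma>_def)
  have e: "(1 - \<gamma>) * (p - 1) = \<alpha> + \<gamma>" "\<alpha> - p + \<gamma> * (p - 1) = - 1 - \<gamma>"
    using p\<gamma> by (auto simp: algebra_simps)
  define C where "C = 1 / \<gamma> powr (p - 1)"
  have C: "0 \<le> C" by (simp add: C_def)
  define G where "G y = ennreal (y powr (\<alpha> + \<gamma>) * g y powr p)" for y
  have [measurable]: "G \<in> borel_measurable borel" unfolding G_def by measurable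
  have "(\<integral>\<^sup>+x\<in>{0<..<b}. ennreal (x powr (\<alpha> - p) * a x powr p) \<partial>lborel) \<le>
      (\<integral>\<^sup>+x. \<integral>\<^sup>+y. ennreal C * (ennreal (x powr (- 1 - \<gamma>)) * indicator {0<..<b} x * (G y * indicator {0<..<x} y)) \<partial>lborel \<partial>lborel)"
  proof (intro nn_integral_mono)
    fix x :: real
    show "ennreal (x powr (\<alpha> - p) * a x powr p) * indicator {0<..<b} x \<le>
      (\<integral>\<^sup>+y. ennreal C * (ennreal (x powr (- 1 - \<gamma>)) * indicator {0<..<b} x * (G y * indicator {0<..<x} y)) \<partial>lborel)"
    proof (cases "0 < x \<and> x < b")
      case True
      then have x: "0 < x" "x < b" by auto
      have "ennreal (a x powr p) \<le> ennreal (x powr (\<gamma> * (p - 1)) * C) * (\<integral>\<^sup>+y\<in>{0<..<x}. G y \<partial>lborel)"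
        using powr_le_nn_integral[OF p \<gamma> x(1) a _ g le[OF x]] by (simp add: e(1) G_def C_def)
      then have "ennreal (x powr (\<alpha> - p)) * ennreal (a x powr p) \<le>
          ennreal (x powr (\<alpha> - p)) * (ennreal (x powr (\<gamma> * (p - 1)) * C) * (\<integral>\<^sup>+y\<in>{0<..<x}. G y \<partial>lborel))"
        by (rule mult_left_mono) simp
      also have "\<dots> = ennreal (x powr (\<alpha> - p) * x powr (\<gamma> * (p - 1)) * C) * (\<integral>\<^sup>+y\<in>{0<..<x}. G y \<partial>lborel)"
        using C by (simp add: ennreal_mult'' mult.assoc)
      also have "x powr (\<alpha> - p) * x powr (\<gamma> * (p - 1)) = x powr (- 1 - \<gamma>)"
        by (simp add: e(2) flip: powr_add)
      also have "ennreal (x powr (- 1 - \<gamma>) * C) * (\<integral>\<^sup>+y\<in>{0<..<x}. G y \<partial>lborel) =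
          (\<integral>\<^sup>+y. ennreal C * (ennreal (x powr (- 1 - \<gamma>)) * (G y * indicator {0<..<x} y)) \<partial>lborel)"
        using C by (simp add: nn_integral_cmult) (simp add: ennreal_mult'' ac_simps)
      finally show ?thesis
        using x a by (simp add: ennreal_mult'')
    qed auto
  qed
  also have "\<dots> = (\<integral>\<^sup>+y. \<integral>\<^sup>+x. ennreal C * (ennreal (x powr (- 1 - \<gamma>)) * indicator {0<..<b} x * (G y * indicator {0<..<x} y)) \<partial>lborel \<partial>lborel)"
    by (rule lborel_pair.Fubini') (measurable, simp)
  also have "\<dots> \<le> (\<integral>\<^sup>+y\<in>{0<..<b}. ennreal ((p / (p - 1 - \<alpha>)) powr p) * ennreal (y powr \<alpha> * g y powr p) \<partial>lborel)"
  proof (intro nn_integral_mono)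
    fix y :: real
    show "(\<integral>\<^sup>+x. ennreal C * (ennreal (x powr (- 1 - \<gamma>)) * indicator {0<..<b} x * (G y * indicator {0<..<x} y)) \<partial>lborel) \<le>
        ennreal ((p / (p - 1 - \<alpha>)) powr p) * ennreal (y powr \<alpha> * g y powr p) * indicator {0<..<b} y"
    proof (cases "0 < y \<and> y < b")
      case True
      then have y: "0 < y" "y < b" by auto
      \<comment> \<open>Enlarging \<open>y < x < b\<close> to \<open>y < x\<close> gives a bound
        free of \<open>b\<close>; the power \<open>- 1 - \<gamma>\<close> is integrable at
        infinity.\<close>
      have "(\<integral>\<^sup>+x. ennreal C * (ennreal (x powr (- 1 - \<gamma>)) * indicator {0<..<b} x * (G y * indicator {0<..<x} y)) \<partial>lborel)
          \<le> (\<integral>\<^sup>+x. ennreal C * G y * (ennreal (x powr (- 1 - \<gamma>)) * indicator {y<..} x) \<partial>lborel)"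
        by (intro nn_integral_mono) (auto split: split_indicator simp: ac_simps)
      also have "\<dots> \<le> ennreal C * G y * ennreal (y powr (- \<gamma>) / \<gamma>)"
        using nn_integral_powr_tail_le[of "- 1 - \<gamma>" y] y \<gamma>
        by (subst nn_integral_cmult) (auto intro!: mult_left_mono)
      also have "\<dots> = ennreal (C / \<gamma> * (y powr (\<alpha> + \<gamma>) * y powr (- \<gamma>)) * g y powr p)"
        using C \<gamma> by (simp add: G_def ac_simps flip: ennreal_mult'')
      also have "y powr (\<alpha> + \<gamma>) * y powr (- \<gamma>) = y powr \<alpha>"
        by (simp flip: powr_add)
      also have "C / \<gamma> = (p / (p - 1 - \<alpha>)) powr p"
      proof -
        have "C / \<gamma> = 1 / \<gamma> powr p"
          using \<gamma> by (simp add: C_def powr_diff)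
        also have "\<dots> = (1 / \<gamma>) powr p"
          using \<gamma> by (simp add: powr_divide)
        finally show ?thesis by (simp add: \<gamma>_def)
      qed
      finally show ?thesis
        using y by (simp add: ennreal_mult'' mult.assoc)
    next
      case False
      then have "(\<integral>\<^sup>+x. ennreal C * (ennreal (x powr (- 1 - \<gamma>)) * indicator {0<..<b} x * (G y * indicator {0<..<x} y)) \<partial>lborel) = (\<integral>\<^sup>+x. 0 \<partial>(lborel :: real measure))"
        by (intro nn_integral_cong) (auto split: split_indicator)
      then show ?thesis by simp
    qed
  qed
  also have "\<dots> = ennreal ((p / (p - 1 - \<alpha>)) powr p) * (\<integral>\<^sup>+y\<in>{0<..<b}. ennreal (y powr \<alpha> * g y powr p) \<partial>lborel)"
    by (simp add: nn_integral_cmult mult.assoc)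
  finally show ?thesis .
qed

section \<open>The two estimates\<close>

text \<open>The Jacobian is spent here: since \<open>\<alpha> - p < - 1\<close>, the product of
  \<open>2 * r\<close> and \<open>(1 + r) powr (\<alpha> - p)\<close> is at most
  \<open>2 * r / (1 + r) \<le> 1\<close>.\<close>

lemma I_integrand_polar_le:
  fixes p \<alpha> r \<tau> :: real
  assumes p: "1 < p" "1 + \<alpha> < p" and r: "0 < r" "r < 1" and \<tau>: "0 \<le> \<tau>" "\<tau> \<le> 1"
  shows "2 * r * ((1 - r\<^sup>2) powr \<alpha> * ((1 - \<tau>\<^sup>2) / (1 - r\<^sup>2)) powr p) \<le>
    2 powr p * ((1 - r) powr (\<alpha> - p) * (1 - \<tau>) powr p)"
proof -
  have fac: "1 - r\<^sup>2 = (1 - r) * (1 + r)" by (simp add: power2_eq_square algebra_simps)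
  have r2: "0 < 1 - r\<^sup>2" unfolding fac using r by simp
  have \<tau>2: "0 \<le> 1 - \<tau>\<^sup>2" using \<tau> by (simp add: abs_square_le_1)
  have "(1 + r) powr (\<alpha> - p) \<le> (1 + r) powr - 1"
    using r p by (intro powr_mono) auto
  then have "2 * r * (1 + r) powr (\<alpha> - p) \<le> 2 * r * (1 + r) powr - 1"
    using r by (intro mult_left_mono) auto
  also have "\<dots> \<le> 1" using r by (simp add: powr_minus field_simps)
  finally have "2 * r * (1 + r) powr (\<alpha> - p) * (1 - r) powr (\<alpha> - p) \<le> 1 * (1 - r) powr (\<alpha> - p)"
    by (rule mult_right_mono) simp
  then have weight: "2 * r * (1 - r\<^sup>2) powr (\<alpha> - p) \<le> (1 - r) powr (\<alpha> - p)"
    unfolding fac using r by (simp add: powr_mult ac_simps)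
  have "1 - \<tau>\<^sup>2 = (1 - \<tau>) * (1 + \<tau>)" by (simp add: power2_eq_square algebra_simps)
  also have "\<dots> \<le> (1 - \<tau>) * 2" using \<tau> by (intro mult_left_mono) auto
  finally have "1 - \<tau>\<^sup>2 \<le> 2 * (1 - \<tau>)" by simp
  then have "(1 - \<tau>\<^sup>2) powr p \<le> (2 * (1 - \<tau>)) powr p"
    using \<tau>2 p by (intro powr_mono2) auto
  also have "(2 * (1 - \<tau>)) powr p = 2 powr p * (1 - \<tau>) powr p"
    by (rule powr_mult)
  finally have numer: "(1 - \<tau>\<^sup>2) powr p \<le> 2 powr p * (1 - \<tau>) powr p" .
  have "2 * r * ((1 - r\<^sup>2) powr \<alpha> * ((1 - \<tau>\<^sup>2) / (1 - r\<^sup>2)) powr p) =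
      (2 * r * (1 - r\<^sup>2) powr (\<alpha> - p)) * (1 - \<tau>\<^sup>2) powr p"
    using r2 \<tau>2 by (simp add: powr_divide powr_diff)
  also have "\<dots> \<le> (1 - r) powr (\<alpha> - p) * (2 powr p * (1 - \<tau>) powr p)"
    using weight numer by (intro mult_mono) auto
  finally show ?thesis by (simp add: ac_simps)
qed

text \<open>For \<open>\<alpha> > - 1\<close> the quotient \<open>(1 + r) powr \<alpha>\<close> of
  the two weights is at least \<open>1 / (1 + r)\<close>, hence at least one half.\<close>

lemma powr_one_minus_le:
  fixes \<alpha> r :: real
  assumes "- 1 < \<alpha>" "0 \<le> r" "r < 1"
  shows "(1 - r) powr \<alpha> \<le> 2 * (1 - r\<^sup>2) powr \<alpha>"
proof -
  have fac: "1 - r\<^sup>2 = (1 - r) * (1 + r)" by (simp add: power2_eq_square algebra_simps)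
  have "1 \<le> 2 * (1 + r) powr - 1" using assms by (simp add: powr_minus field_simps)
  also have "\<dots> \<le> 2 * (1 + r) powr \<alpha>"
    using assms by (intro mult_left_mono powr_mono) auto
  finally have "(1 - r) powr \<alpha> * 1 \<le> (1 - r) powr \<alpha> * (2 * (1 + r) powr \<alpha>)"
    by (intro mult_left_mono) auto
  then show ?thesis unfolding fac using assms by (simp add: powr_mult ac_simps)
qed

lemma nn_integral_reflect:
  fixes f :: "real \<Rightarrow> ennreal"
  assumes "f \<in> borel_measurable borel"
  shows "(\<integral>\<^sup>+x. f (c - x) \<partial>lborel) = (\<integral>\<^sup>+x. f x \<partial>lborel)"
  using nn_integral_real_affine[OF assms, of "- 1" c] by simp

text \<open>The point \<open>1 - 2 powr (- 1 / (\<alpha> + 1))\<close> halves the mass of the weight \<open>(1 - r) powr \<alpha>\<close> on \<open>(0, 1)\<close>.\<close>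
lemma nn_integral_mono_weight_le:
  fixes \<alpha> :: real and N :: "real \<Rightarrow> ennreal"
  assumes \<alpha>: "- 1 < \<alpha>" and [measurable]: "N \<in> borel_measurable borel"
    and mono: "\<And>s r. 0 < s \<Longrightarrow> s \<le> r \<Longrightarrow> r < 1 \<Longrightarrow> N s \<le> N r"
  shows "(\<integral>\<^sup>+r\<in>{0<..<1}. ennreal ((1 - r) powr \<alpha>) * N r \<partial>lborel) \<le>
    ennreal (1 / (1 - 2 powr (- 1 / (\<alpha> + 1)))) *
      (\<integral>\<^sup>+r\<in>{0<..<1}. ennreal (2 * r) * (ennreal ((1 - r) powr \<alpha>) * N r) \<partial>lborel)"
proof -
  define c where "c = 2 powr (- 1 / (\<alpha> + 1))"
  have c: "0 < c" "c < 1" using \<alpha> by (auto simp: c_def intro!: powr_less_one)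
  have c_half: "c powr (\<alpha> + 1) = 1 / 2"
  proof -
    have "c powr (\<alpha> + 1) = 2 powr (- 1 / (\<alpha> + 1) * (\<alpha> + 1))" by (simp only: c_def powr_powr)
    also have "- 1 / (\<alpha> + 1) * (\<alpha> + 1) = - 1" using \<alpha> by simp
    finally show ?thesis by (simp add: powr_minus)
  qed
  define d where "d = 1 - c"
  have d: "0 < d" "d < 1" using c by (auto simp: d_def)
  define w where "w r = ennreal ((1 - r) powr \<alpha>)" for r
  have [measurable]: "w \<in> borel_measurable borel" unfolding w_def by measurable
  define m where "m = 1 / 2 / (\<alpha> + 1)"
  have m: "0 \<le> m" "1 / (\<alpha> + 1) = 2 * m" using \<alpha> by (simp_all add: m_def divide_simps)
  have right: "(\<integral>\<^sup>+r\<in>{d<..<1}. w r \<partial>lborel) = ennreal m"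
  proof -
    have "(\<integral>\<^sup>+r\<in>{d<..<1}. w r \<partial>lborel) = (\<integral>\<^sup>+x. w (1 - x) * indicator {d<..<1} (1 - x) \<partial>lborel)"
      by (rule nn_integral_reflect[symmetric]) measurable
    also have "\<dots> = (\<integral>\<^sup>+x\<in>{0<..<c}. ennreal (x powr \<alpha>) \<partial>lborel)"
      by (intro nn_integral_cong) (auto simp: w_def d_def split: split_indicator)
    also have "\<dots> = ennreal m"
      using nn_integral_powr_from_0[OF \<alpha>, of c] c c_half by (simp add: m_def)
    finally show ?thesis .
  qed
  have total: "(\<integral>\<^sup>+r\<in>{0<..<1}. w r \<partial>lborel) = ennreal (2 * m)"
  proof -
    have "(\<integral>\<^sup>+r\<in>{0<..<1}. w r \<partial>lborel) = (\<integral>\<^sup>+x. w (1 - x) * indicator {0<..<1} (1 - x) \<partial>lborel)"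
      by (rule nn_integral_reflect[symmetric]) measurable
    also have "\<dots> = (\<integral>\<^sup>+x\<in>{0<..<1}. ennreal (x powr \<alpha>) \<partial>lborel)"
      by (intro nn_integral_cong) (auto simp: w_def split: split_indicator)
    also have "\<dots> = ennreal (2 * m)"
      using nn_integral_powr_from_0[OF \<alpha>, of 1] m(2) by simp
    finally show ?thesis .
  qed
  have split: "(\<integral>\<^sup>+r\<in>{0<..<1}. F r \<partial>lborel) = (\<integral>\<^sup>+r\<in>{0<..<d}. F r \<partial>lborel) + (\<integral>\<^sup>+r\<in>{d<..<1}. F r \<partial>lborel)"
    if [measurable]: "F \<in> borel_measurable borel" for F :: "real \<Rightarrow> ennreal"
  proof -
    have "(\<integral>\<^sup>+r\<in>{0<..<1}. F r \<partial>lborel) = (\<integral>\<^sup>+r. F r * indicator {0<..<d} r + F r * indicator {d<..<1} r \<partial>lborel)"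
      using d by (intro nn_integral_cong_AE eventually_mono[OF AE_lborel_singleton[of d]]) (auto split: split_indicator)
    then show ?thesis by (simp add: nn_integral_add)
  qed
  have left: "(\<integral>\<^sup>+r\<in>{0<..<d}. w r \<partial>lborel) = ennreal m"
  proof -
    have "(\<integral>\<^sup>+r\<in>{0<..<d}. w r \<partial>lborel) + ennreal m = ennreal m + ennreal m"
      using split[of w] m right total by (simp flip: ennreal_plus)
    then show ?thesis by (simp add: add.commute ennreal_add_left_cancel)
  qed
  define R where "R = (\<integral>\<^sup>+r\<in>{d<..<1}. w r * N r \<partial>lborel)"
  \<comment> \<open>Monotonicity puts \<open>N\<close> below \<open>N d\<close> to the left of
    \<open>d\<close> and above it to the right. Both sides carry the same mass \<open>m\<close>, so
    the left integral is at most the right one.\<close>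
  have "(\<integral>\<^sup>+r\<in>{0<..<d}. w r * N r \<partial>lborel) \<le> (\<integral>\<^sup>+r. N d * (w r * indicator {0<..<d} r) \<partial>lborel)"
    using d by (intro nn_integral_mono) (auto split: split_indicator simp: mult.commute intro!: mult_right_mono mono)
  also have "\<dots> = N d * ennreal m" by (simp add: nn_integral_cmult left)
  also have "\<dots> = (\<integral>\<^sup>+r. N d * (w r * indicator {d<..<1} r) \<partial>lborel)" by (simp add: nn_integral_cmult right)
  also have "\<dots> \<le> R"
    unfolding R_def using d by (intro nn_integral_mono) (auto split: split_indicator simp: mult.commute intro!: mult_right_mono mono)
  finally have "(\<integral>\<^sup>+r\<in>{0<..<1}. w r * N r \<partial>lborel) \<le> R + R"
    by (subst split) (auto simp: R_def intro: add_right_mono)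
  also have "R + R = ennreal 2 * R" by (simp add: mult_2)
  also have "\<dots> = (\<integral>\<^sup>+r. ennreal 2 * (w r * N r * indicator {d<..<1} r) \<partial>lborel)"
    unfolding R_def by (rule nn_integral_cmult[symmetric]) measurable
  also have "\<dots> \<le> (\<integral>\<^sup>+r. ennreal (1 / d) * (ennreal (2 * r) * (w r * N r) * indicator {0<..<1} r) \<partial>lborel)"
  proof (intro nn_integral_mono)
    fix r
    show "ennreal 2 * (w r * N r * indicator {d<..<1} r) \<le> ennreal (1 / d) * (ennreal (2 * r) * (w r * N r) * indicator {0<..<1} r)"
    proof (cases "d < r \<and> r < 1")
      case True
      then have "ennreal 2 \<le> ennreal (1 / d * (2 * r))"
        using d by (intro ennreal_leI) (simp add: field_simps)
      then have "ennreal 2 * (w r * N r) \<le> ennreal (1 / d * (2 * r)) * (w r * N r)"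
        by (rule mult_right_mono) simp
      also have "ennreal (1 / d * (2 * r)) = ennreal (1 / d) * ennreal (2 * r)"
        using True d by (intro ennreal_mult) auto
      finally show ?thesis
        using True d by (simp add: mult.assoc)
    qed auto
  qed
  also have "\<dots> = ennreal (1 / d) * (\<integral>\<^sup>+r\<in>{0<..<1}. ennreal (2 * r) * (w r * N r) \<partial>lborel)"
    by (rule nn_integral_cmult) measurable
  finally show ?thesis
    by (simp add: w_def d_def c_def)
qed

text \<open>The factors are listed by origin: numerator bound, Hardy constant, restored Jacobian,
  change of weight. The third is \<open>x / (x - 1) = 1 / (1 - 1 / x)\<close> for
  \<open>x = 2 powr (1 / (\<alpha> + 1))\<close>.\<close>

lemma K_pow_altdef:
  assumes "- 1 < \<alpha>"
  shows "K_pow p \<alpha> = 2 powr p * (p / (p - 1 - \<alpha>)) powr p * (1 / (1 - 2 powr (- 1 / (\<alpha> + 1)))) * 2"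
proof -
  define x :: real where "x = 2 powr (1 / (\<alpha> + 1))"
  have x: "1 < x" using assms by (simp add: x_def)
  have inv: "2 powr (- 1 / (\<alpha> + 1)) = 1 / x" by (simp add: x_def powr_minus_divide)
  have "1 / (1 - 2 powr (- 1 / (\<alpha> + 1))) = x / (x - 1)"
    unfolding inv using x by (simp add: field_simps)
  then show ?thesis
    by (simp add: K_pow_def x_def powr_add)
qed

text \<open>The substitution \<open>r = 1 - x\<close> moves the boundary point to 0, where Hardy's
  inequality is stated, and the unit modulus of \<open>w\<close> turns the radial increment into
  \<open>1 - cmod (f (of_real r * \<zeta>))\<close>.\<close>

lemma radial_hardy:
  assumes p: "1 < p" "1 + \<alpha> < p" and hol: "f holomorphic_on unit_disc"
    and le: "\<And>z. cmod z < 1 \<Longrightarrow> cmod (f z) \<le> 1"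
    and \<zeta>: "cmod \<zeta> = 1" and w: "has_radial_limit f \<zeta> w" "cmod w = 1"
  shows "(\<integral>\<^sup>+r\<in>{0<..<1}. ennreal ((1 - r) powr (\<alpha> - p) * (1 - cmod (f (of_real r * \<zeta>))) powr p) \<partial>lborel) \<le>
    ennreal ((p / (p - 1 - \<alpha>)) powr p) *
      (\<integral>\<^sup>+r\<in>{0<..<1}. ennreal ((1 - r) powr \<alpha> * cmod (deriv f (of_real r * \<zeta>)) powr p) \<partial>lborel)"
proof -
  have in_disc: "of_real r * \<zeta> \<in> unit_disc" if "r \<in> {0<..<1}" for r :: real
    using that \<zeta> by (simp add: norm_mult)
  \<comment> \<open>Cut off outside (0, 1), since Hardy's inequality asks for measurability and
    nonnegativity on the whole line while \<open>f\<close> is arbitrary off the disc.\<close>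
  define a where "a r = indicator {0<..<1} r * (1 - cmod (f (of_real r * \<zeta>)))" for r :: real
  define g where "g r = indicator {0<..<1} r * cmod (deriv f (of_real r * \<zeta>))" for r :: real
  have cont: "continuous_on {0<..<1} (\<lambda>r. F (of_real r * \<zeta>))" if "F holomorphic_on unit_disc" for F :: "complex \<Rightarrow> complex"
  proof -
    have "continuous_on {0<..<1::real} (F \<circ> (\<lambda>r. of_real r * \<zeta>))"
      using in_disc
      by (intro continuous_on_compose continuous_intros
          continuous_on_subset[OF holomorphic_on_imp_continuous_on[OF that]]) blast
    then show ?thesis by (simp add: o_def)
  qed
  have meas: "(\<lambda>r. indicator {0<..<1} r *\<^sub>R g r) \<in> borel_measurable borel"
    if "continuous_on {0<..<1} g" for g :: "real \<Rightarrow> real"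
    using that by (intro borel_measurable_continuous_on_indicator) simp_all
  have [measurable]: "a \<in> borel_measurable borel"
  proof -
    have "continuous_on {0<..<1} (\<lambda>r. 1 - cmod (f (of_real r * \<zeta>)))"
      by (intro continuous_intros cont hol)
    from meas[OF this] show ?thesis by (simp add: a_def[abs_def])
  qed
  have [measurable]: "g \<in> borel_measurable borel"
  proof -
    have "continuous_on {0<..<1} (\<lambda>r. cmod (deriv f (of_real r * \<zeta>)))"
      by (intro continuous_intros cont holomorphic_deriv hol) simp
    from meas[OF this] show ?thesis by (simp add: g_def[abs_def])
  qed
  have "(\<integral>\<^sup>+r\<in>{0<..<1}. ennreal ((1 - r) powr (\<alpha> - p) * (1 - cmod (f (of_real r * \<zeta>))) powr p) \<partial>lborel) =
      (\<integral>\<^sup>+r\<in>{0<..<1}. ennreal ((1 - r) powr (\<alpha> - p) * a r powr p) \<partial>lborel)"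
    by (intro nn_integral_cong) (auto simp: a_def split: split_indicator)
  also have "\<dots> = (\<integral>\<^sup>+x. ennreal ((1 - (1 - x)) powr (\<alpha> - p) * a (1 - x) powr p) * indicator {0<..<1} (1 - x) \<partial>lborel)"
    by (rule nn_integral_reflect[symmetric]) measurable
  also have "\<dots> = (\<integral>\<^sup>+x\<in>{0<..<1}. ennreal (x powr (\<alpha> - p) * a (1 - x) powr p) \<partial>lborel)"
    by (intro nn_integral_cong) (auto split: split_indicator)
  also have "\<dots> \<le> ennreal ((p / (p - 1 - \<alpha>)) powr p) * (\<integral>\<^sup>+y\<in>{0<..<1}. ennreal (y powr \<alpha> * g (1 - y) powr p) \<partial>lborel)"
  proof (rule hardy_inequality)
    have "0 \<le> a r" for r
      using in_disc[of r] le[of "of_real r * \<zeta>"] by (auto simp: a_def split: split_indicator)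
    then show "0 \<le> a (1 - x)" for x .
    show "0 \<le> g (1 - y)" for y by (simp add: g_def)
    show "ennreal (a (1 - x)) \<le> (\<integral>\<^sup>+y\<in>{0<..<x}. ennreal (g (1 - y)) \<partial>lborel)" if x: "0 < x" "x < 1" for x
    proof -
      have "ennreal (a (1 - x)) \<le> (\<integral>\<^sup>+s\<in>{1-x<..<1}. ennreal (cmod (deriv f (of_real s * \<zeta>))) \<partial>lborel)"
        using radial_increment_le[OF hol \<zeta> w(1), of "1 - x"] x w(2) by (simp add: a_def)
      also have "\<dots> = (\<integral>\<^sup>+s\<in>{1-x<..<1}. ennreal (g s) \<partial>lborel)"
        using x by (intro nn_integral_cong) (auto simp: g_def split: split_indicator)
      also have "\<dots> = (\<integral>\<^sup>+y. ennreal (g (1 - y)) * indicator {1-x<..<1} (1 - y) \<partial>lborel)"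
        by (rule nn_integral_reflect[symmetric]) measurable
      also have "\<dots> = (\<integral>\<^sup>+y\<in>{0<..<x}. ennreal (g (1 - y)) \<partial>lborel)"
        by (intro nn_integral_cong) (auto split: split_indicator)
      finally show ?thesis .
    qed
  qed (use p in auto)
  also have "(\<integral>\<^sup>+y\<in>{0<..<1}. ennreal (y powr \<alpha> * g (1 - y) powr p) \<partial>lborel) =
      (\<integral>\<^sup>+y. ennreal ((1 - (1 - y)) powr \<alpha> * g (1 - y) powr p) * indicator {0<..<1} (1 - y) \<partial>lborel)"
    by (intro nn_integral_cong) (auto split: split_indicator)
  also have "\<dots> = (\<integral>\<^sup>+r\<in>{0<..<1}. ennreal ((1 - r) powr \<alpha> * g r powr p) \<partial>lborel)"
    by (rule nn_integral_reflect) measurable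
  also have "\<dots> = (\<integral>\<^sup>+r\<in>{0<..<1}. ennreal ((1 - r) powr \<alpha> * cmod (deriv f (of_real r * \<zeta>)) powr p) \<partial>lborel)"
    by (intro nn_integral_cong) (auto simp: g_def split: split_indicator)
  finally show ?thesis .
qed

section \<open>The lower and the upper estimate\<close>

lemma bergman_norm_pow_le_I_integral:
  assumes p: "1 < p" and inner: "inner_function \<Theta>"
  shows "bergman_norm_pow p \<alpha> (deriv \<Theta>) \<le> I_integral p \<alpha> \<Theta>"
  unfolding bergman_norm_pow_def I_integral_def
proof (intro nn_integral_mono)
  fix u
  have hol: "\<Theta> holomorphic_on unit_disc"
    using inner by (auto simp: inner_function_def H_infinity_def)
  show "ennreal ((1 - (cmod u)\<^sup>2) powr \<alpha> * cmod (deriv \<Theta> u) powr p) * indicator unit_disc u \<le>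
    ennreal ((1 - (cmod u)\<^sup>2) powr \<alpha> * ((1 - (cmod (\<Theta> u))\<^sup>2) / (1 - (cmod u)\<^sup>2)) powr p) * indicator unit_disc u"
  proof (cases "cmod u < 1")
    case True
    then have "0 < 1 - (cmod u)\<^sup>2" by (simp add: abs_square_less_1)
    then have "cmod (deriv \<Theta> u) \<le> (1 - (cmod (\<Theta> u))\<^sup>2) / (1 - (cmod u)\<^sup>2)"
      using Schwarz_Pick[OF hol inner_function_norm_le_1[OF inner] True] by (simp add: pos_le_divide_eq)
    then show ?thesis
      using p by (intro mult_right_mono ennreal_leI mult_left_mono powr_mono2) auto
  qed simp
qed

lemma I_integral_le_bergman_norm_pow:
  assumes p: "1 < p" "1 + \<alpha> < p" and \<alpha>: "- 1 < \<alpha>" and inner: "inner_function \<Theta>"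
  shows "I_integral p \<alpha> \<Theta> \<le> ennreal (K_pow p \<alpha>) * bergman_norm_pow p \<alpha> (deriv \<Theta>)"
proof -
  have hol: "\<Theta> holomorphic_on unit_disc"
    using inner by (auto simp: inner_function_def H_infinity_def)
  have hol': "deriv \<Theta> holomorphic_on unit_disc"
    using hol by (intro holomorphic_deriv) auto
  note le1 = inner_function_norm_le_1[OF inner]
  \<comment> \<open>Extension by zero makes both functions Borel on the whole plane, as the polar
    formula requires.\<close>
  define T where "T u = indicator unit_disc u *\<^sub>R \<Theta> u" for u
  define D where "D u = indicator unit_disc u *\<^sub>R deriv \<Theta> u" for u
  have [measurable]: "T \<in> borel_measurable borel" "D \<in> borel_measurable borel"
    unfolding T_def D_def using hol hol'
    by (auto intro!: borel_measurable_continuous_on_indicator holomorphic_on_imp_continuous_on)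
  have [measurable]: "cis \<in> borel_measurable borel"
    by (intro borel_measurable_continuous_onI continuous_intros)
  have T: "T (of_real r * cis t) = \<Theta> (of_real r * cis t)" and D: "D (of_real r * cis t) = deriv \<Theta> (of_real r * cis t)"
    if "0 < r" "r < 1" for r t
    using that by (simp_all add: T_def D_def norm_mult)
  have T_le: "cmod (T u) \<le> 1" for u
    using le1 by (auto simp: T_def split: split_indicator)
  define N where "N r = (\<integral>\<^sup>+t. ennreal (cmod (D (of_real r * cis t)) powr p) \<partial>circle_mean)" for r :: real
  have [measurable]: "N \<in> borel_measurable borel" unfolding N_def by measurable
  define H where "H = (p / (p - 1 - \<alpha>)) powr p"
  define c where "c = 1 / (1 - 2 powr (- 1 / (\<alpha> + 1)))"
  have "2 powr (- 1 / (\<alpha> + 1)) < (1 :: real)" using \<alpha> by (intro powr_less_one) auto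
  then have c: "0 \<le> c" by (simp add: c_def)
  have H: "0 \<le> H" by (simp add: H_def)

  have bergman: "bergman_norm_pow p \<alpha> (deriv \<Theta>) =
      (\<integral>\<^sup>+r\<in>{0<..<1}. ennreal (2 * r) * (ennreal ((1 - r\<^sup>2) powr \<alpha>) * N r) \<partial>lborel)"
  proof -
    have "bergman_norm_pow p \<alpha> (deriv \<Theta>) =
        (\<integral>\<^sup>+u. ennreal ((1 - (cmod u)\<^sup>2) powr \<alpha> * cmod (D u) powr p) * indicator unit_disc u \<partial>area_measure)"
      unfolding bergman_norm_pow_def by (intro nn_integral_cong) (auto simp: D_def split: split_indicator)
    also have "\<dots> = (\<integral>\<^sup>+r\<in>{0<..<1}. ennreal (2 * r) * (\<integral>\<^sup>+t. ennreal ((1 - (cmod (of_real r * cis t))\<^sup>2) powr \<alpha> *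
        cmod (D (of_real r * cis t)) powr p) * indicator unit_disc (of_real r * cis t) \<partial>circle_mean) \<partial>lborel)"
      by (rule nn_integral_area_measure_polar) (intro borel_measurable_times_ennreal borel_measurable_indicator; measurable?; simp?)
    also have "\<dots> = (\<integral>\<^sup>+r\<in>{0<..<1}. ennreal (2 * r) * (ennreal ((1 - r\<^sup>2) powr \<alpha>) * N r) \<partial>lborel)"
      by (intro nn_integral_cong)
         (auto simp: norm_mult N_def ennreal_mult nn_integral_cmult split: split_indicator)
    finally show ?thesis .
  qed

  have "I_integral p \<alpha> \<Theta> =
      (\<integral>\<^sup>+u. ennreal ((1 - (cmod u)\<^sup>2) powr \<alpha> * ((1 - (cmod (T u))\<^sup>2) / (1 - (cmod u)\<^sup>2)) powr p) * indicator unit_disc u \<partial>area_measure)"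
    unfolding I_integral_def by (intro nn_integral_cong) (auto simp: T_def split: split_indicator)
  also have "\<dots> = (\<integral>\<^sup>+r\<in>{0<..<1}. ennreal (2 * r) * (\<integral>\<^sup>+t. ennreal ((1 - (cmod (of_real r * cis t))\<^sup>2) powr \<alpha> *
      ((1 - (cmod (T (of_real r * cis t)))\<^sup>2) / (1 - (cmod (of_real r * cis t))\<^sup>2)) powr p) *
      indicator unit_disc (of_real r * cis t) \<partial>circle_mean) \<partial>lborel)"
    by (rule nn_integral_area_measure_polar) (intro borel_measurable_times_ennreal borel_measurable_indicator; measurable?; simp?)
  also have "\<dots> \<le> (\<integral>\<^sup>+r. \<integral>\<^sup>+t. ennreal (2 powr p) *
      (ennreal ((1 - r) powr (\<alpha> - p) * (1 - cmod (T (of_real r * cis t))) powr p) * indicator {0<..<1} r) \<partial>circle_mean \<partial>lborel)"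
  proof (intro nn_integral_mono)
    fix r :: real
    show "ennreal (2 * r) * (\<integral>\<^sup>+t. ennreal ((1 - (cmod (of_real r * cis t))\<^sup>2) powr \<alpha> *
        ((1 - (cmod (T (of_real r * cis t)))\<^sup>2) / (1 - (cmod (of_real r * cis t))\<^sup>2)) powr p) *
        indicator unit_disc (of_real r * cis t) \<partial>circle_mean) * indicator {0<..<1} r \<le>
      (\<integral>\<^sup>+t. ennreal (2 powr p) *
        (ennreal ((1 - r) powr (\<alpha> - p) * (1 - cmod (T (of_real r * cis t))) powr p) * indicator {0<..<1} r) \<partial>circle_mean)"
    proof (cases "0 < r \<and> r < 1")
      case True
      then have r: "0 < r" "r < 1" by auto
      have "ennreal (2 * r) * (\<integral>\<^sup>+t. ennreal ((1 - (cmod (of_real r * cis t))\<^sup>2) powr \<alpha> *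
        ((1 - (cmod (T (of_real r * cis t)))\<^sup>2) / (1 - (cmod (of_real r * cis t))\<^sup>2)) powr p) *
        indicator unit_disc (of_real r * cis t) \<partial>circle_mean) =
        (\<integral>\<^sup>+t. ennreal (2 * r) * ennreal ((1 - r\<^sup>2) powr \<alpha> * ((1 - (cmod (T (of_real r * cis t)))\<^sup>2) / (1 - r\<^sup>2)) powr p) \<partial>circle_mean)"
        using r by (simp add: norm_mult nn_integral_cmult)
      also have "\<dots> \<le> (\<integral>\<^sup>+t. ennreal (2 powr p) *
        ennreal ((1 - r) powr (\<alpha> - p) * (1 - cmod (T (of_real r * cis t))) powr p) \<partial>circle_mean)"
        using I_integrand_polar_le[OF p r norm_ge_zero T_le] r
        by (intro nn_integral_mono) (auto intro!: ennreal_leI simp flip: ennreal_mult)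
      finally show ?thesis using r by simp
    qed auto
  qed
  also have "\<dots> = (\<integral>\<^sup>+t. \<integral>\<^sup>+r. ennreal (2 powr p) *
      (ennreal ((1 - r) powr (\<alpha> - p) * (1 - cmod (T (of_real r * cis t))) powr p) * indicator {0<..<1} r) \<partial>lborel \<partial>circle_mean)"
    by (rule circle_line.Fubini') measurable
  also have "\<dots> = (\<integral>\<^sup>+t. ennreal (2 powr p) *
      (\<integral>\<^sup>+r\<in>{0<..<1}. ennreal ((1 - r) powr (\<alpha> - p) * (1 - cmod (T (of_real r * cis t))) powr p) \<partial>lborel) \<partial>circle_mean)"
    by (intro nn_integral_cong nn_integral_cmult) measurable
  also have "\<dots> \<le> (\<integral>\<^sup>+t. ennreal (2 powr p) * (ennreal H *
      (\<integral>\<^sup>+r\<in>{0<..<1}. ennreal ((1 - r) powr \<alpha> * cmod (D (of_real r * cis t)) powr p) \<partial>lborel)) \<partial>circle_mean)"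
  proof (intro nn_integral_mono_AE eventually_mono[OF AE_circle_mean_inner[OF inner]])
    fix t assume "\<exists>w. has_radial_limit \<Theta> (cis t) w \<and> cmod w = 1"
    then obtain w where w: "has_radial_limit \<Theta> (cis t) w" "cmod w = 1" by blast
    have "(\<integral>\<^sup>+r\<in>{0<..<1}. ennreal ((1 - r) powr (\<alpha> - p) * (1 - cmod (T (of_real r * cis t))) powr p) \<partial>lborel) =
        (\<integral>\<^sup>+r\<in>{0<..<1}. ennreal ((1 - r) powr (\<alpha> - p) * (1 - cmod (\<Theta> (of_real r * cis t))) powr p) \<partial>lborel)"
      by (intro nn_integral_cong) (auto simp: T split: split_indicator)
    also have "\<dots> \<le> ennreal H * (\<integral>\<^sup>+r\<in>{0<..<1}. ennreal ((1 - r) powr \<alpha> * cmod (deriv \<Theta> (of_real r * cis t)) powr p) \<partial>lborel)"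
      unfolding H_def by (rule radial_hardy[OF p hol le1 _ w]) simp_all
    also have "(\<integral>\<^sup>+r\<in>{0<..<1}. ennreal ((1 - r) powr \<alpha> * cmod (deriv \<Theta> (of_real r * cis t)) powr p) \<partial>lborel) =
        (\<integral>\<^sup>+r\<in>{0<..<1}. ennreal ((1 - r) powr \<alpha> * cmod (D (of_real r * cis t)) powr p) \<partial>lborel)"
      by (intro nn_integral_cong) (auto simp: D split: split_indicator)
    finally show "ennreal (2 powr p) * (\<integral>\<^sup>+r\<in>{0<..<1}. ennreal ((1 - r) powr (\<alpha> - p) * (1 - cmod (T (of_real r * cis t))) powr p) \<partial>lborel) \<le>
      ennreal (2 powr p) * (ennreal H * (\<integral>\<^sup>+r\<in>{0<..<1}. ennreal ((1 - r) powr \<alpha> * cmod (D (of_real r * cis t)) powr p) \<partial>lborel))"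
      by (rule mult_left_mono) simp
  qed
  also have "\<dots> = ennreal (2 powr p) * (ennreal H * (\<integral>\<^sup>+t. \<integral>\<^sup>+r. ennreal ((1 - r) powr \<alpha> * cmod (D (of_real r * cis t)) powr p) *
      indicator {0<..<1} r \<partial>lborel \<partial>circle_mean))"
    by (simp add: nn_integral_cmult)
  also have "(\<integral>\<^sup>+t. \<integral>\<^sup>+r. ennreal ((1 - r) powr \<alpha> * cmod (D (of_real r * cis t)) powr p) * indicator {0<..<1} r \<partial>lborel \<partial>circle_mean) =
      (\<integral>\<^sup>+r. \<integral>\<^sup>+t. ennreal ((1 - r) powr \<alpha> * cmod (D (of_real r * cis t)) powr p) * indicator {0<..<1} r \<partial>circle_mean \<partial>lborel)"
    by (rule circle_line.Fubini'[symmetric]) measurable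
  also have "\<dots> = (\<integral>\<^sup>+r\<in>{0<..<1}. ennreal ((1 - r) powr \<alpha>) * N r \<partial>lborel)"
    by (intro nn_integral_cong) (auto simp: N_def ennreal_mult nn_integral_cmult split: split_indicator)
  also have "\<dots> \<le> ennreal c * (\<integral>\<^sup>+r\<in>{0<..<1}. ennreal (2 * r) * (ennreal ((1 - r) powr \<alpha>) * N r) \<partial>lborel)"
    unfolding c_def
  proof (rule nn_integral_mono_weight_le[OF \<alpha>])
    show "N s \<le> N r" if "0 < s" "s \<le> r" "r < 1" for s r
      using circle_mean_powr_mono[OF hol' p(1), of s r] that by (simp add: N_def D)
  qed measurable
  also have "(\<integral>\<^sup>+r\<in>{0<..<1}. ennreal (2 * r) * (ennreal ((1 - r) powr \<alpha>) * N r) \<partial>lborel) \<le>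
      (\<integral>\<^sup>+r. ennreal 2 * (ennreal (2 * r) * (ennreal ((1 - r\<^sup>2) powr \<alpha>) * N r) * indicator {0<..<1} r) \<partial>lborel)"
  proof (intro nn_integral_mono)
    fix r :: real
    have "ennreal (2 * r) * (ennreal ((1 - r) powr \<alpha>) * N r) \<le> ennreal (2 * r) * (ennreal (2 * (1 - r\<^sup>2) powr \<alpha>) * N r)" if "0 < r" "r < 1"
      using powr_one_minus_le[OF \<alpha>, of r] that by (intro mult_left_mono mult_right_mono ennreal_leI) auto
    then show "ennreal (2 * r) * (ennreal ((1 - r) powr \<alpha>) * N r) * indicator {0<..<1} r \<le>
        ennreal 2 * (ennreal (2 * r) * (ennreal ((1 - r\<^sup>2) powr \<alpha>) * N r) * indicator {0<..<1} r)"
      by (auto simp: ennreal_mult ac_simps split: split_indicator)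
  qed
  also have "\<dots> = ennreal 2 * bergman_norm_pow p \<alpha> (deriv \<Theta>)"
    unfolding bergman by (rule nn_integral_cmult) measurable
  finally have "I_integral p \<alpha> \<Theta> \<le> ennreal (2 powr p) * (ennreal H * (ennreal c * (ennreal 2 * bergman_norm_pow p \<alpha> (deriv \<Theta>))))"
    by (simp add: mult_left_mono)
  also have "\<dots> = ennreal (2 powr p * H * c * 2) * bergman_norm_pow p \<alpha> (deriv \<Theta>)"
    using c H by (simp only: ennreal_mult mult_nonneg_nonneg powr_ge_zero zero_le_numeral mult.assoc)
  also have "2 powr p * H * c * 2 = K_pow p \<alpha>"
    unfolding K_pow_altdef[OF \<alpha>] H_def c_def ..
  finally show ?thesis .
qed

theorem theorem2p4:
  fixes p \<alpha> :: real and \<Theta> :: "complex \<Rightarrow> complex"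
  assumes "1 < p" and "\<alpha> > - 1" and "p > 1 + \<alpha>" and "inner_function \<Theta>"
  shows "bergman_norm_pow p \<alpha> (deriv \<Theta>) \<le> I_integral p \<alpha> \<Theta> \<and>
    I_integral p \<alpha> \<Theta> \<le> ennreal (K_pow p \<alpha>) * bergman_norm_pow p \<alpha> (deriv \<Theta>)"
  using bergman_norm_pow_le_I_integral I_integral_le_bergman_norm_pow assms by blast

end
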